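(* Let $\mu$ be a probability measure on $\mathbb R^d$ supported on the closed Euclidean ball $B(0,R)=\{x\in\mathbb R^d:\|x\|\le R\}$ for some $R\ge 0$. Then, for each $t>0$, the convolution $\mu*\gamma_{0,t}$, where $\gamma_{0,t}$ is the centered Gaussian measure on $\mathbb R^d$ with covariance $tI_d$, satisfies a log-Sobolev inequality with constant $$C_{\rm LS}(\mu*\gamma_{0,t})\le 6\,(4R^2+t)\,e^{4R^2/t}.$$
   Context: For a probability measure $\rho$ on $\mathbb R^d$, $C_{\rm LS}(\rho)$ denotes the smallest constant $C$ such that $\operatorname{ent}_\rho(f^2)\le 2C\,\mathbb E_\rho\|\nabla f\|^2$ for all $f\in C_{\rm b}^\infty(\mathbb R^d)$ (bounded, infinitely differentiable functions all of whose derivatives are bounded), where for $g\ge 0$, $\operatorname{ent}_\rho(g)=\mathbb E_\rho(g\log g)-\mathbb E_\rho g\,\log\mathbb E_\rho g$, with $0\log0=0$. The measure $\rho$ satisfies a log-Sobolev inequality if $C_{\rm LS}(\rho)<\infty$. *)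

theory Defs
  imports "HOL-Probability.Probability"
begin

definition partial_deriv :: "'d::finite \<Rightarrow> (real ^ 'd \<Rightarrow> real) \<Rightarrow> real ^ 'd \<Rightarrow> real" where
  "partial_deriv i f x = frechet_derivative f (at x) (axis i 1)"

definition gradient :: "(real ^ 'd::finite \<Rightarrow> real) \<Rightarrow> real ^ 'd \<Rightarrow> real ^ 'd" where
  "gradient f x = (\<chi> i. partial_deriv i f x)"

primrec Cb :: "nat \<Rightarrow> (real ^ 'd::finite \<Rightarrow> real) \<Rightarrow> bool" where
  "Cb 0 f \<longleftrightarrow> continuous_on UNIV f \<and> bounded (range f)"
| "Cb (Suc k) f \<longleftrightarrow> bounded (range f) \<and> (\<forall>x. f differentiable (at x)) \<and>
     (\<forall>i. Cb k (partial_deriv i f))"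

definition Cb_infty :: "(real ^ 'd::finite \<Rightarrow> real) set" where
  "Cb_infty = {f. \<forall>k. Cb k f}"

definition ent :: "'a measure \<Rightarrow> ('a \<Rightarrow> real) \<Rightarrow> real" where
  "ent \<rho> g = (\<integral>x. g x * ln (g x) \<partial>\<rho>) - (\<integral>x. g x \<partial>\<rho>) * ln (\<integral>x. g x \<partial>\<rho>)"

definition log_sobolev_ineq :: "(real ^ 'd::finite) measure \<Rightarrow> real \<Rightarrow> bool" where
  "log_sobolev_ineq \<rho> C \<longleftrightarrow>
     (\<forall>f\<in>Cb_infty. ent \<rho> (\<lambda>x. (f x)\<^sup>2) \<le> 2 * C * (\<integral>x. (norm (gradient f x))\<^sup>2 \<partial>\<rho>))"

text \<open>The value is \<open>\<infinity>\<close> when no real constant is admissible; otherwise the infimum is attained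
  (see \<open>C_LS_le_iff\<close>).\<close>

definition C_LS :: "(real ^ 'd::finite) measure \<Rightarrow> ereal" where
  "C_LS \<rho> = (INF C \<in> {C. log_sobolev_ineq \<rho> C}. ereal C)"

definition satisfies_log_sobolev :: "(real ^ 'd::finite) measure \<Rightarrow> bool" where
  "satisfies_log_sobolev \<rho> \<longleftrightarrow> C_LS \<rho> < \<infinity>"

text \<open>Lebesgue density of the centered Gaussian with covariance \<open>t\<close> times the identity;
  meaningful for \<open>t > 0\<close>.\<close>

definition gaussian :: "real \<Rightarrow> (real ^ 'd::finite) measure" where
  "gaussian t = density lborel
     (\<lambda>x. ennreal ((2 * pi * t) powr (- real CARD('d) / 2) * exp (- (norm x)\<^sup>2 / (2 * t))))"

lemma log_sobolev_ineq_mono: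
  assumes "log_sobolev_ineq \<rho> C" "C \<le> D"
  shows "log_sobolev_ineq \<rho> D"
  unfolding log_sobolev_ineq_def
proof
  fix f :: "real ^ 'a \<Rightarrow> real" assume f: "f \<in> Cb_infty"
  have "2 * C * (\<integral>x. (norm (gradient f x))\<^sup>2 \<partial>\<rho>) \<le> 2 * D * (\<integral>x. (norm (gradient f x))\<^sup>2 \<partial>\<rho>)"
    using assms(2) by (intro mult_right_mono) auto
  with assms(1) f show "ent \<rho> (\<lambda>x. (f x)\<^sup>2) \<le> 2 * D * (\<integral>x. (norm (gradient f x))\<^sup>2 \<partial>\<rho>)"
    unfolding log_sobolev_ineq_def by fastforce
qed

lemma C_LS_le_iff: "C_LS \<rho> \<le> ereal C \<longleftrightarrow> log_sobolev_ineq \<rho> C"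
proof
  assume "log_sobolev_ineq \<rho> C"
  then show "C_LS \<rho> \<le> ereal C"
    unfolding C_LS_def by (intro INF_lower) auto
next
  assume le: "C_LS \<rho> \<le> ereal C"
  have above: "log_sobolev_ineq \<rho> D" if "C < D" for D
  proof -
    have "C_LS \<rho> < ereal D" using le that by (simp add: le_less_trans)
    then obtain C' where "log_sobolev_ineq \<rho> C'" "C' < D"
      unfolding C_LS_def by (auto simp: INF_less_iff)
    then show ?thesis using log_sobolev_ineq_mono[of \<rho> C' D] by simp
  qed
  show "log_sobolev_ineq \<rho> C"
    unfolding log_sobolev_ineq_def
  proof
    fix f :: "real ^ 'a \<Rightarrow> real" assume f: "f \<in> Cb_infty"
    let ?E = "\<integral>x. (norm (gradient f x))\<^sup>2 \<partial>\<rho>"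
    have "((\<lambda>D. 2 * D * ?E) \<longlongrightarrow> 2 * C * ?E) (at_right C)"
      by (intro tendsto_intros)
    moreover have "eventually (\<lambda>D. ent \<rho> (\<lambda>x. (f x)\<^sup>2) \<le> 2 * D * ?E) (at_right C)"
      using above f unfolding log_sobolev_ineq_def
      by (auto simp: eventually_at_filter intro!: always_eventually)
    ultimately show "ent \<rho> (\<lambda>x. (f x)\<^sup>2) \<le> 2 * C * ?E"
      by (rule tendsto_lowerbound) simp
  qed
qed

end

theory Submission imports Defs begin

text \<open>Write \<open>P F x\<close> for the mean of \<open>F (x + z)\<close> when \<open>z\<close> is Gaussian with covariance \<open>t\<close> times the
  identity (\<open>heat t F x\<close> below), \<open>Ent\<close> and \<open>Var\<close> for the entropy and the variance of a function under
  that law, and \<open>K = exp (4 R\<^sup>2 / t)\<close>. The measure \<open>\<rho> = \<mu> * \<gamma>\<close> is a mixture of the translates of one Gaussian by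
  points of a ball, any two of which are at distance at most \<open>2 R\<close>. So each component satisfies
  functional inequalities on the scale \<open>t\<close>, and any two components are comparable: the second
  moment of the density of one with respect to the other is at most \<open>K\<close>. Three facts are combined.

  First, a single Gaussian satisfies \<open>Var f \<le> t P |V|\<^sup>2\<close> and \<open>Ent (f\<^sup>2) \<le> 4 t P |V|\<^sup>2\<close>, where \<open>V\<close> is
  the gradient of \<open>f\<close> (\<open>heat_poincare\<close>, \<open>heat_log_sobolev\<close>). Both are instances of \<open>heat_entropy\<close>: by the
  semigroup property, an entropy over time \<open>t\<close> is a sum of entropies over \<open>n\<close> steps of length
  \<open>t / n\<close>. Over a short step, the entropy is controlled by the mean square of an increment, which is
  the step length times the squared gradient up to an error of order \<open>(t / n) powr (3/2)\<close>; these
  errors disappear as \<open>n\<close> grows. Derivatives are never taken under an integral, since only a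
  quadratic Taylor estimate has to be propagated. The constant \<open>4\<close> is twice the optimal one, which
  the final bound can afford.

  Secondly, these inequalities pass to the mixture. For the variance, the Cauchy-Schwarz inequality
  bounds \<open>(P f y - P f x)\<^sup>2\<close> by \<open>(K - 1) Var f\<close> (\<open>heat_difference_square\<close>), so that the
  variance of \<open>f\<close> under \<open>\<rho>\<close> is at most \<open>t K\<close> times the energy (\<open>mixture_poincare\<close>). For the
  entropy, the duality between entropy and exponential moments gives a Harnack inequality
  \<open>P F y \<ge> P F x exp (- Ent F / P F x) / K\<close> (\<open>heat_harnack\<close>). Averaging it over \<open>y\<close> shows that
  replacing \<open>ln (P F x)\<close> by the logarithm of the global mean costs one more \<open>Ent F\<close> and
  the term \<open>ln K\<close> times the mean of \<open>F\<close>. The result is a log-Sobolev inequality with the additional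
  term \<open>(4 R\<^sup>2 / t)\<close> times the mean of \<open>f\<^sup>2\<close> (\<open>mixture_defective_log_sobolev\<close>).

  Thirdly, the additional term is absorbed by centering. With \<open>m\<close> the mean of \<open>f\<close>, the
  entropy of \<open>f\<^sup>2\<close> exceeds that of \<open>(f - m)\<^sup>2\<close> by at most \<open>4\<close> times the variance (\<open>ent_square_shift\<close>, a form of
  Rothaus' lemma), and for a centered function the mean of the square is the variance, to which
  the Poincare inequality applies. With \<open>D\<close> the mean of the squared gradient, the total is at most
  \<open>8 t D + (4 R\<^sup>2 / t + 4) t K D \<le> 12 (4 R\<^sup>2 + t) K D\<close>.\<close>

section \<open>The Gaussian measure\<close>

definition gaussian_density :: "real \<Rightarrow> real ^ 'd::finite \<Rightarrow> real" where
  "gaussian_density t x =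
     (2 * pi * t) powr (- real CARD('d) / 2) * exp (- (norm x)\<^sup>2 / (2 * t))"

lemma gaussian_eq: "gaussian t = density lborel (\<lambda>x. ennreal (gaussian_density t x))"
  by (simp add: gaussian_def gaussian_density_def)

lemma gaussian_density_nonneg [simp]: "0 \<le> gaussian_density t x"
  by (simp add: gaussian_density_def)

lemma borel_measurable_gaussian_density [measurable]: "gaussian_density t \<in> borel_measurable borel"
  unfolding gaussian_density_def by measurable

lemma sets_gaussian [simp, measurable_cong]: "sets (gaussian t) = sets borel"
  by (simp add: gaussian_def)

lemma space_gaussian [simp]: "space (gaussian t) = UNIV"
  by (simp add: gaussian_def)

text \<open>Factorization over the coordinates reduces the normalization to the one-dimensional integral; every
  other Gaussian integral below follows from the normalization by completing squares.\<close>

lemma gaussian_density_prod: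
  fixes x :: "real ^ 'd::finite"
  assumes "t > 0"
  shows "gaussian_density t x = (\<Prod>b\<in>Basis. normal_density 0 (sqrt t) (x \<bullet> b))"
proof -
  have "(\<Prod>b\<in>(Basis :: (real ^ 'd) set). normal_density 0 (sqrt t) (x \<bullet> b))
      = (\<Prod>b\<in>(Basis :: (real ^ 'd) set). 1 / sqrt (2 * pi * t)) * (\<Prod>b\<in>Basis. exp (- (x \<bullet> b)\<^sup>2 / (2 * t)))"
    unfolding prod.distrib[symmetric] using assms by (simp add: normal_density_def)
  also have "(\<Prod>b\<in>(Basis :: (real ^ 'd) set). 1 / sqrt (2 * pi * t)) = (2 * pi * t) powr (- real CARD('d) / 2)"
  proof -
    have "1 / sqrt (2 * pi * t) = (2 * pi * t) powr (- (1/2))"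
      using assms by (simp add: powr_minus_divide powr_half_sqrt)
    then show ?thesis
      using assms by (simp add: powr_powr flip: powr_realpow)
  qed
  also have "(\<Prod>b\<in>Basis. exp (- (x \<bullet> b)\<^sup>2 / (2 * t))) = exp (- (norm x)\<^sup>2 / (2 * t))"
    unfolding exp_sum[OF finite_Basis, symmetric] power2_norm_eq_inner euclidean_inner[of x x]
    by (simp add: sum_negf sum_divide_distrib[symmetric] power2_eq_square)
  finally show ?thesis by (simp add: gaussian_density_def)
qed

lemma nn_integral_gaussian_density:
  assumes "t > 0"
  shows "(\<integral>\<^sup>+x. ennreal (gaussian_density t (x :: real ^ 'd::finite)) \<partial>lborel) = 1"
proof -
  have "(\<integral>\<^sup>+x. ennreal (gaussian_density t (x :: real ^ 'd)) \<partial>lborel)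
      = (\<integral>\<^sup>+x. (\<Prod>b\<in>(Basis :: (real ^ 'd) set). ennreal (normal_density 0 (sqrt t) (x \<bullet> b))) \<partial>lborel)"
    using assms by (simp add: gaussian_density_prod prod_ennreal)
  also have "\<dots> = (\<Prod>b\<in>(Basis :: (real ^ 'd) set). (\<integral>\<^sup>+x. ennreal (normal_density 0 (sqrt t) x) \<partial>lborel))"
    by (rule nn_integral_lborel_prod) auto
  also have "\<dots> = 1"
    using assms by (simp add: nn_integral_eq_integral)
  finally show ?thesis .
qed

lemma prob_space_gaussian: "t > 0 \<Longrightarrow> prob_space (gaussian t)"
  by (rule prob_spaceI) (simp add: gaussian_eq emeasure_density nn_integral_gaussian_density)

lemma nn_integral_lborel_translate:
  fixes F :: "'a::euclidean_space \<Rightarrow> ennreal"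
  assumes [measurable]: "F \<in> borel_measurable borel"
  shows "(\<integral>\<^sup>+x. F (c + x) \<partial>lborel) = (\<integral>\<^sup>+x. F x \<partial>lborel)"
proof -
  have "(\<integral>\<^sup>+x. F x \<partial>distr lborel borel ((+) c)) = (\<integral>\<^sup>+x. F (c + x) \<partial>lborel)"
    by (rule nn_integral_distr) measurable
  then show ?thesis by (simp add: lborel_distr_plus)
qed

text \<open>Completing the square in the exponent. The second factor on the right is, as a function of \<open>x\<close>, a
  translated Gaussian density, so integrating over \<open>x\<close> yields the convolution formula below without
  any further integral.\<close>

lemma gaussian_density_mult:
  fixes x w :: "real ^ 'd::finite"
  assumes "s > 0" "t > 0"
  shows "gaussian_density s x * gaussian_density t (w - x)
       = gaussian_density (s + t) w * gaussian_density (s * t / (s + t)) (x - (s / (s + t)) *\<^sub>R w)"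
proof -
  let ?e = "- real CARD('d) / 2"
  have c: "(2 * pi * s) powr ?e * (2 * pi * t) powr ?e
         = (2 * pi * (s + t)) powr ?e * (2 * pi * (s * t / (s + t))) powr ?e"
  proof -
    have "(2 * pi * s) * (2 * pi * t) = (2 * pi * (s + t)) * (2 * pi * (s * t / (s + t)))"
      using assms by (simp add: field_simps)
    then show ?thesis
      using assms by (simp only: powr_mult[symmetric])
  qed
  have "- (norm x)\<^sup>2 / (2 * s) + - (norm (w - x))\<^sup>2 / (2 * t)
      = - (norm w)\<^sup>2 / (2 * (s + t))
        + - (norm (x - (s / (s + t)) *\<^sub>R w))\<^sup>2 / (2 * (s * t / (s + t)))" (is "?l = ?r")
  proof -
    define a b d where "a = x \<bullet> x" and "b = x \<bullet> w" and "d = w \<bullet> w"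
    have l: "?l = - a / (2 * s) + - (d - 2 * b + a) / (2 * t)"
      by (simp add: power2_norm_eq_inner inner_diff_left inner_diff_right inner_commute a_def b_def d_def)
    have r: "?r = - d / (2 * (s + t)) + - (a - 2 * (s / (s + t)) * b + (s / (s + t)) * (s / (s + t)) * d) / (2 * (s * t / (s + t)))"
      by (simp add: power2_norm_eq_inner inner_diff_left inner_diff_right inner_commute a_def b_def d_def algebra_simps)
    have "s + t \<noteq> 0" using assms by simp
    then show ?thesis unfolding l r using assms
      by (simp add: divide_simps) algebra
  qed
  then have e: "exp (- (norm x)\<^sup>2 / (2 * s)) * exp (- (norm (w - x))\<^sup>2 / (2 * t))
      = exp (- (norm w)\<^sup>2 / (2 * (s + t)))
        * exp (- (norm (x - (s / (s + t)) *\<^sub>R w))\<^sup>2 / (2 * (s * t / (s + t))))"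
    by (simp only: exp_add[symmetric])
  have "gaussian_density s x * gaussian_density t (w - x)
      = ((2 * pi * s) powr ?e * (2 * pi * t) powr ?e)
        * (exp (- (norm x)\<^sup>2 / (2 * s)) * exp (- (norm (w - x))\<^sup>2 / (2 * t)))"
    by (simp add: gaussian_density_def)
  then show ?thesis
    unfolding c e by (simp add: gaussian_density_def)
qed

lemma convolution_gaussian:
  assumes "s > 0" "t > 0"
  shows "convolution (gaussian s) (gaussian t) = (gaussian (s + t) :: (real ^ 'd::finite) measure)"
proof (rule measure_eqI)
  show "sets (convolution (gaussian s) (gaussian t)) = sets (gaussian (s + t) :: (real ^ 'd) measure)"
    by simp
  interpret s: prob_space "gaussian s :: (real ^ 'd) measure" by (rule prob_space_gaussian) fact
  interpret t: prob_space "gaussian t :: (real ^ 'd) measure" by (rule prob_space_gaussian) fact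
  fix B :: "(real ^ 'd) set" assume "B \<in> sets (convolution (gaussian s) (gaussian t))"
  then have [measurable]: "B \<in> sets borel" by simp
  let ?F = "\<lambda>x. indicator B x :: ennreal"
  define r where "r = s * t / (s + t)"
  have r: "r > 0" using assms by (simp add: r_def)
  have "emeasure (convolution (gaussian s) (gaussian t)) B = (\<integral>\<^sup>+x. ?F x \<partial>convolution (gaussian s) (gaussian t))"
    by simp
  also have "\<dots> = (\<integral>\<^sup>+x. \<integral>\<^sup>+y. ?F (x + y) \<partial>gaussian t \<partial>gaussian s)"
    by (rule nn_integral_convolution) (auto intro: s.finite_measure_axioms t.finite_measure_axioms)
  also have "\<dots> = (\<integral>\<^sup>+x. gaussian_density s x * (\<integral>\<^sup>+y. gaussian_density t y * ?F (x + y) \<partial>lborel) \<partial>lborel)"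
    unfolding gaussian_eq by (subst nn_integral_density nn_integral_density; measurable)+
  also have "\<dots> = (\<integral>\<^sup>+x. (\<integral>\<^sup>+w. gaussian_density s x * (gaussian_density t (w - x) * ?F w) \<partial>lborel) \<partial>lborel)"
  proof (rule nn_integral_cong)
    fix x :: "real ^ 'd"
    have "(\<integral>\<^sup>+y. gaussian_density t y * ?F (x + y) \<partial>lborel)
        = (\<integral>\<^sup>+y. (\<lambda>w. ennreal (gaussian_density t (w - x)) * ?F w) (x + y) \<partial>lborel)"
      by simp
    also have "\<dots> = (\<integral>\<^sup>+w. gaussian_density t (w - x) * ?F w \<partial>lborel)"
      by (rule nn_integral_lborel_translate) measurable
    finally show "ennreal (gaussian_density s x) * (\<integral>\<^sup>+y. gaussian_density t y * ?F (x + y) \<partial>lborel)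
        = (\<integral>\<^sup>+w. gaussian_density s x * (gaussian_density t (w - x) * ?F w) \<partial>lborel)"
      by (simp add: nn_integral_cmult)
  qed
  also have "\<dots> = (\<integral>\<^sup>+w. (\<integral>\<^sup>+x. gaussian_density s x * (gaussian_density t (w - x) * ?F w) \<partial>lborel) \<partial>lborel)"
    by (rule lborel_pair.Fubini') measurable
  also have "\<dots> = (\<integral>\<^sup>+w. gaussian_density (s + t) w * ?F w \<partial>lborel)"
  proof (rule nn_integral_cong)
    fix w :: "real ^ 'd"
    have "(\<integral>\<^sup>+x. gaussian_density s x * (gaussian_density t (w - x) * ?F w) \<partial>lborel)
        = (\<integral>\<^sup>+x. (gaussian_density (s + t) w * ?F w) * gaussian_density r (- ((s / (s + t)) *\<^sub>R w) + x) \<partial>lborel)"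
      using gaussian_density_mult[OF assms, of _ w]
      by (intro nn_integral_cong) (simp add: ennreal_mult[symmetric] r_def mult_ac split: split_indicator)
    also have "\<dots> = gaussian_density (s + t) w * ?F w"
      by (subst nn_integral_cmult, measurable,
          subst nn_integral_lborel_translate[of "\<lambda>x. ennreal (gaussian_density r x)"])
        (simp_all add: nn_integral_gaussian_density r)
    finally show "(\<integral>\<^sup>+x. gaussian_density s x * (gaussian_density t (w - x) * ?F w) \<partial>lborel)
        = gaussian_density (s + t) w * ?F w" .
  qed
  also have "\<dots> = (\<integral>\<^sup>+x. ?F x \<partial>gaussian (s + t))"
    unfolding gaussian_eq by (subst nn_integral_density; measurable)
  finally show "emeasure (convolution (gaussian s) (gaussian t)) B = emeasure (gaussian (s + t)) B"
    by simp
qed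

text \<open>The Cameron-Martin formula. Together with the normalization it gives all exponential moments, and
  from these the polynomial moments are estimated.\<close>

lemma nn_integral_gaussian_translate:
  fixes F :: "real ^ 'd::finite \<Rightarrow> ennreal"
  assumes "t > 0" and [measurable]: "F \<in> borel_measurable borel"
  shows "(\<integral>\<^sup>+z. F (w + z) \<partial>gaussian t)
       = (\<integral>\<^sup>+z. F z * ennreal (exp ((w \<bullet> z) / t - (norm w)\<^sup>2 / (2 * t))) \<partial>gaussian t)"
proof -
  have dens: "gaussian_density t (z - w) = gaussian_density t z * exp ((w \<bullet> z) / t - (norm w)\<^sup>2 / (2 * t))" for z :: "real ^ 'd"
  proof -
    have "- (norm (z - w))\<^sup>2 / (2 * t) = - (norm z)\<^sup>2 / (2 * t) + ((w \<bullet> z) / t - (norm w)\<^sup>2 / (2 * t))"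
      using assms(1) by (simp add: power2_norm_eq_inner inner_diff_left inner_diff_right inner_commute field_simps)
    then show ?thesis
      by (simp only: gaussian_density_def exp_add mult.assoc)
  qed
  have "(\<integral>\<^sup>+z. F (w + z) \<partial>gaussian t) = (\<integral>\<^sup>+z. (\<lambda>y. ennreal (gaussian_density t (y - w)) * F y) (w + z) \<partial>lborel)"
    unfolding gaussian_eq by (subst nn_integral_density) simp_all
  also have "\<dots> = (\<integral>\<^sup>+y. gaussian_density t (y - w) * F y \<partial>lborel)"
    by (rule nn_integral_lborel_translate) measurable
  also have "\<dots> = (\<integral>\<^sup>+y. gaussian_density t y * (F y * ennreal (exp ((w \<bullet> y) / t - (norm w)\<^sup>2 / (2 * t)))) \<partial>lborel)"
    by (simp add: dens ennreal_mult mult_ac)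
  also have "\<dots> = (\<integral>\<^sup>+z. F z * ennreal (exp ((w \<bullet> z) / t - (norm w)\<^sup>2 / (2 * t))) \<partial>gaussian t)"
    unfolding gaussian_eq by (subst nn_integral_density) measurable
  finally show ?thesis .
qed

lemma nn_integral_gaussian_exp:
  fixes v :: "real ^ 'd::finite"
  assumes "t > 0"
  shows "(\<integral>\<^sup>+z. ennreal (exp (v \<bullet> z)) \<partial>gaussian t) = ennreal (exp (t * (norm v)\<^sup>2 / 2))"
proof -
  interpret prob_space "gaussian t :: (real ^ 'd) measure" by (rule prob_space_gaussian) fact
  have eq: "exp (v \<bullet> z) = exp (t * (norm v)\<^sup>2 / 2) * exp (((t *\<^sub>R v) \<bullet> z) / t - (norm (t *\<^sub>R v))\<^sup>2 / (2 * t))" for z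
    using assms by (simp add: exp_add[symmetric] field_simps power2_eq_square)
  have "(\<integral>\<^sup>+z. ennreal (exp (v \<bullet> z)) \<partial>gaussian t)
      = ennreal (exp (t * (norm v)\<^sup>2 / 2)) * (\<integral>\<^sup>+z. 1 * ennreal (exp (((t *\<^sub>R v) \<bullet> z) / t - (norm (t *\<^sub>R v))\<^sup>2 / (2 * t))) \<partial>gaussian t)"
    unfolding eq by (subst nn_integral_cmult[symmetric]) (auto simp: ennreal_mult)
  also have "(\<integral>\<^sup>+z. 1 * ennreal (exp (((t *\<^sub>R v) \<bullet> z) / t - (norm (t *\<^sub>R v))\<^sup>2 / (2 * t))) \<partial>(gaussian t :: (real ^ 'd) measure)) = 1"
    using nn_integral_gaussian_translate[OF assms, of "\<lambda>_. 1" "t *\<^sub>R v"] by (simp add: emeasure_space_1[simplified])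
  finally show ?thesis by simp
qed

lemma
  fixes v :: "real ^ 'd::finite"
  assumes "t > 0"
  shows integrable_gaussian_exp: "integrable (gaussian t) (\<lambda>z. exp (v \<bullet> z))"
    and integral_gaussian_exp: "(\<integral>z. exp (v \<bullet> z) \<partial>gaussian t) = exp (t * (norm v)\<^sup>2 / 2)"
proof -
  show "integrable (gaussian t) (\<lambda>z. exp (v \<bullet> z))"
    by (rule integrableI_nn_integral_finite[OF _ _ nn_integral_gaussian_exp[OF assms]]) auto
  then show "(\<integral>z. exp (v \<bullet> z) \<partial>gaussian t) = exp (t * (norm v)\<^sup>2 / 2)"
    using nn_integral_gaussian_exp[OF assms, of v] by (simp add: nn_integral_eq_integral)
qed

lemma integral_gaussian_translate:
  fixes F :: "real ^ 'd::finite \<Rightarrow> real"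
  assumes "t > 0" and [measurable]: "F \<in> borel_measurable borel" and "\<And>x. \<bar>F x\<bar> \<le> B"
  shows "integrable (gaussian t) (\<lambda>z. F z * exp ((w \<bullet> z) / t - (norm w)\<^sup>2 / (2 * t)))" (is ?I)
    and "(\<integral>z. F (w + z) \<partial>gaussian t)
       = (\<integral>z. F z * exp ((w \<bullet> z) / t - (norm w)\<^sup>2 / (2 * t)) \<partial>gaussian t)" (is ?E)
proof -
  let ?q = "\<lambda>z. exp ((w \<bullet> z) / t - (norm w)\<^sup>2 / (2 * t))"
  interpret prob_space "gaussian t :: (real ^ 'd) measure" by (rule prob_space_gaussian) fact
  have q: "?q z = exp (((1 / t) *\<^sub>R w) \<bullet> z) * exp (- (norm w)\<^sup>2 / (2 * t))" for z
    by (simp add: exp_add[symmetric])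
  have "integrable (gaussian t) (\<lambda>z. B * ?q z)"
    unfolding q using integrable_gaussian_exp[OF assms(1), of "(1 / t) *\<^sub>R w"] by simp
  then show I: ?I
    by (rule Bochner_Integration.integrable_bound) (auto simp: abs_mult intro!: AE_I2 mult_right_mono order_trans[OF assms(3)])
  have eq: "(\<integral>z. F (w + z) \<partial>gaussian t) = (\<integral>y. F y \<partial>distr (gaussian t) borel ((+) w))"
    by (subst integral_distr) auto
  have "distr (gaussian t) borel ((+) w) = density (gaussian t) (\<lambda>z. ennreal (?q z))"
  proof (rule measure_eqI)
    fix A assume "A \<in> sets (distr (gaussian t) borel ((+) w))"
    then have [measurable]: "A \<in> sets borel" by simp
    have "emeasure (distr (gaussian t) borel ((+) w)) A = (\<integral>\<^sup>+y. indicator A y \<partial>distr (gaussian t) borel ((+) w))"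
      by simp
    also have "\<dots> = (\<integral>\<^sup>+z. indicator A (w + z) \<partial>gaussian t)"
      by (rule nn_integral_distr) auto
    also have "\<dots> = (\<integral>\<^sup>+z. indicator A z * ennreal (?q z) \<partial>gaussian t)"
      by (rule nn_integral_gaussian_translate[OF assms(1)]) measurable
    also have "\<dots> = emeasure (density (gaussian t) (\<lambda>z. ennreal (?q z))) A"
      by (subst emeasure_density) (auto simp: mult.commute)
    finally show "emeasure (distr (gaussian t) borel ((+) w)) A = emeasure (density (gaussian t) (\<lambda>z. ennreal (?q z))) A" .
  qed simp
  then show ?E unfolding eq
    by (simp add: integral_density mult.commute)
qed

section \<open>Moments of the Gaussian measure\<close>

lemma cosh_ge_quartic: "1 + y\<^sup>2 / 2 + y ^ 4 / 24 \<le> cosh (y :: real)"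
proof -
  let ?f = "\<lambda>n::nat. if even n then y ^ n /\<^sub>R fact n else 0"
  have "sum ?f {0, 2, 4} \<le> suminf ?f"
  proof (rule sum_le_suminf)
    show "summable ?f" using cosh_converges[of y] by (rule sums_summable)
    show "0 \<le> ?f n" for n by (cases "even n") (simp_all add: zero_le_even_power)
  qed simp
  also have "suminf ?f = cosh y" using cosh_converges[of y] by (rule sums_unique[symmetric])
  also have "sum ?f {0, 2, 4} = 1 + y\<^sup>2 / 2 + y ^ 4 / 24"
    by (simp add: fact_numeral)
  finally show ?thesis .
qed

lemma
  fixes v :: "real ^ 'd::finite"
  assumes "t > 0"
  shows integrable_gaussian_cosh: "integrable (gaussian t) (\<lambda>z. cosh (v \<bullet> z))"
    and integral_gaussian_cosh: "(\<integral>z. cosh (v \<bullet> z) \<partial>gaussian t) = exp (t * (norm v)\<^sup>2 / 2)"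
proof -
  have I: "integrable (gaussian t) (\<lambda>z. exp (v \<bullet> z))" "integrable (gaussian t) (\<lambda>z. exp (- (v \<bullet> z)))"
    using integrable_gaussian_exp[OF assms, of v] integrable_gaussian_exp[OF assms, of "- v"] by simp_all
  then show "integrable (gaussian t) (\<lambda>z. cosh (v \<bullet> z))"
    unfolding cosh_def by simp
  show "(\<integral>z. cosh (v \<bullet> z) \<partial>gaussian t) = exp (t * (norm v)\<^sup>2 / 2)"
    using I integral_gaussian_exp[OF assms, of v] integral_gaussian_exp[OF assms, of "- v"]
    unfolding cosh_def by simp
qed

lemma integrable_gaussian_moments:
  fixes v :: "real ^ 'd::finite"
  assumes "t > 0"
  shows "integrable (gaussian t) (\<lambda>z. (v \<bullet> z)\<^sup>2)" "integrable (gaussian t) (\<lambda>z. (v \<bullet> z) ^ 4)"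
proof -
  have I: "integrable (gaussian t) (\<lambda>z. 24 * cosh (v \<bullet> z))"
    using integrable_gaussian_cosh[OF assms, of v] by simp
  have le: "\<bar>y\<^sup>2\<bar> \<le> \<bar>24 * cosh y\<bar>" "\<bar>y ^ 4\<bar> \<le> \<bar>24 * cosh y\<bar>" for y :: real
  proof -
    have "0 \<le> y\<^sup>2" "0 \<le> y ^ 4" by simp_all
    then show "\<bar>y\<^sup>2\<bar> \<le> \<bar>24 * cosh y\<bar>" "\<bar>y ^ 4\<bar> \<le> \<bar>24 * cosh y\<bar>"
      using cosh_ge_quartic[of y] by linarith+
  qed
  show "integrable (gaussian t) (\<lambda>z. (v \<bullet> z)\<^sup>2)"
    by (rule Bochner_Integration.integrable_bound[OF I]) (measurable, simp only: real_norm_def le AE_I2)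
  show "integrable (gaussian t) (\<lambda>z. (v \<bullet> z) ^ 4)"
    by (rule Bochner_Integration.integrable_bound[OF I]) (measurable, simp only: real_norm_def le AE_I2)
qed

text \<open>The second moment is the second order coefficient of the exponential moment. Comparing with \<open>cosh\<close>
  at a small multiple of \<open>v\<close> and letting that multiple tend to zero gives the sharp upper bound, which
  determines the constants of the inequalities for a single Gaussian.\<close>

lemma gaussian_second_moment:
  fixes v :: "real ^ 'd::finite"
  assumes t: "t > 0"
  shows "(\<integral>z. (v \<bullet> z)\<^sup>2 \<partial>gaussian t) \<le> t * (norm v)\<^sup>2"
proof (cases "v = 0")
  case False
  interpret prob_space "gaussian t :: (real ^ 'd) measure" by (rule prob_space_gaussian) fact
  define c where "c = t * (norm v)\<^sup>2"
  have c: "c > 0" using t False by (simp add: c_def)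
  let ?m = "\<integral>z. (v \<bullet> z)\<^sup>2 \<partial>gaussian t"
  have bound: "?m \<le> c * (1 + u)" if u: "0 < u" "u < 1" for u
  proof -
    \<comment> \<open>the exponent is scaled so that the exponential moment is \<open>exp u\<close>\<close>
    define l where "l = sqrt (2 * u / c)"
    have l: "l\<^sup>2 = 2 * u / c" using u c by (simp add: l_def)
    have "1 + (u / c) * (v \<bullet> z)\<^sup>2 \<le> cosh ((l *\<^sub>R v) \<bullet> z)" for z
    proof -
      have "(u / c) * (v \<bullet> z)\<^sup>2 = (l * (v \<bullet> z))\<^sup>2 / 2"
        by (simp add: power_mult_distrib l)
      moreover have "0 \<le> (l * (v \<bullet> z)) ^ 4" by simp
      ultimately show ?thesis
        using cosh_ge_quartic[of "l * (v \<bullet> z)"] unfolding inner_scaleR_left by linarith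
    qed
    then have "(\<integral>z. 1 + (u / c) * (v \<bullet> z)\<^sup>2 \<partial>gaussian t) \<le> (\<integral>z. cosh ((l *\<^sub>R v) \<bullet> z) \<partial>gaussian t)"
      using integrable_gaussian_moments(1)[OF t, of v]
      by (intro integral_mono integrable_gaussian_cosh[OF t]) auto
    also have "\<dots> = exp (l\<^sup>2 * c / 2)"
      by (simp only: integral_gaussian_cosh[OF t]) (simp add: c_def power_mult_distrib mult_ac)
    also have "\<dots> = exp u" using c by (simp add: l)
    also have "\<dots> \<le> 1 + u + u\<^sup>2" using u by (intro exp_bound) auto
    also have "(\<integral>z. 1 + (u / c) * (v \<bullet> z)\<^sup>2 \<partial>gaussian t) = 1 + (u / c) * ?m"
      using integrable_gaussian_moments(1)[OF t, of v] by (simp add: prob_space[simplified])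
    finally have "u * (?m / c) \<le> u * (1 + u)"
      by (simp add: power2_eq_square algebra_simps)
    then have "?m / c \<le> 1 + u" using u(1) by (rule mult_left_le_imp_le)
    then show ?thesis using c by (simp add: field_simps)
  qed
  have "((\<lambda>u. c * (1 + u)) \<longlongrightarrow> c * (1 + 0)) (at_right 0)"
    by (intro tendsto_intros)
  moreover have "eventually (\<lambda>u. ?m \<le> c * (1 + u)) (at_right 0)"
    unfolding eventually_at_right_field by (intro exI[of _ 1]) (auto intro: bound)
  ultimately have "?m \<le> c * (1 + 0)"
    by (rule tendsto_lowerbound) simp
  then show ?thesis by (simp add: c_def)
qed simp

text \<open>A dimensional constant for the fourth moment. It enters only the error terms that vanish in the limit of
  small time steps, so its size does not matter and the final constant is dimension-free.\<close>

definition quartic_const :: "'d::finite itself \<Rightarrow> real" where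
  "quartic_const _ = 24 * exp (1 / 2) * (real CARD('d))\<^sup>2"

lemma norm_power4_le:
  fixes z :: "real ^ 'd::finite"
  shows "norm z ^ 4 \<le> real CARD('d) * (\<Sum>b\<in>Basis. (b \<bullet> z) ^ 4)"
proof -
  have "norm z ^ 4 = (\<Sum>b\<in>Basis. (b \<bullet> z)\<^sup>2)\<^sup>2"
    using power2_norm_eq_inner[of z] euclidean_inner[of z z]
    by (simp add: power2_eq_square power4_eq_xxxx inner_commute)
  also have "\<dots> \<le> (\<Sum>b\<in>(Basis :: (real ^ 'd) set). ((b \<bullet> z)\<^sup>2)\<^sup>2) * card (Basis :: (real ^ 'd) set)"
    by (rule sum_squared_le_sum_of_squares)
  finally show ?thesis by (simp add: mult.commute)
qed

lemma
  assumes t: "t > 0"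
  shows integrable_gaussian_norm4: "integrable (gaussian t) (\<lambda>z :: real ^ 'd::finite. norm z ^ 4)"
    and gaussian_fourth_moment:
      "(\<integral>z. norm (z :: real ^ 'd) ^ 4 \<partial>gaussian t) \<le> quartic_const TYPE('d) * t\<^sup>2"
proof -
  interpret prob_space "gaussian t :: (real ^ 'd) measure" by (rule prob_space_gaussian) fact
  let ?S = "\<lambda>z :: real ^ 'd. real CARD('d) * (\<Sum>b\<in>Basis. (b \<bullet> z) ^ 4)"
  have S: "integrable (gaussian t) ?S"
    by (intro integrable_mult_right Bochner_Integration.integrable_sum integrable_gaussian_moments t)
  show I: "integrable (gaussian t) (\<lambda>z :: real ^ 'd. norm z ^ 4)"
    by (rule Bochner_Integration.integrable_bound[OF S])
       (auto intro!: AE_I2 order_trans[OF norm_power4_le] abs_ge_self)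
  have b: "(\<integral>z. (b \<bullet> z) ^ 4 \<partial>gaussian t) \<le> 24 * t\<^sup>2 * exp (1 / 2)" if "b \<in> Basis" for b :: "real ^ 'd"
  proof -
    have "(\<integral>z. (b \<bullet> z) ^ 4 \<partial>gaussian t) \<le> (\<integral>z. 24 * t\<^sup>2 * cosh (((1 / sqrt t) *\<^sub>R b) \<bullet> z) \<partial>gaussian t)"
    proof (intro integral_mono integrable_mult_right integrable_gaussian_cosh integrable_gaussian_moments t)
      fix z
      have "(sqrt t) ^ 4 = t\<^sup>2" using t by (simp add: power4_eq_xxxx power2_eq_square)
      then have "((b \<bullet> z) / sqrt t) ^ 4 = (b \<bullet> z) ^ 4 / t\<^sup>2"
        by (simp add: power_divide)
      then have "(b \<bullet> z) ^ 4 / t\<^sup>2 \<le> 24 * cosh ((b \<bullet> z) / sqrt t)"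
        using cosh_ge_quartic[of "(b \<bullet> z) / sqrt t"] zero_le_power2[of "(b \<bullet> z) / sqrt t"] by linarith
      then show "(b \<bullet> z) ^ 4 \<le> 24 * t\<^sup>2 * cosh (((1 / sqrt t) *\<^sub>R b) \<bullet> z)"
        using t by (simp add: field_simps)
    qed
    also have "\<dots> = 24 * t\<^sup>2 * (\<integral>z. cosh (((1 / sqrt t) *\<^sub>R b) \<bullet> z) \<partial>gaussian t)"
      by (rule integral_mult_right_zero)
    also have "(\<integral>z. cosh (((1 / sqrt t) *\<^sub>R b) \<bullet> z) \<partial>gaussian t) = exp (1 / 2)"
      unfolding integral_gaussian_cosh[OF t] using t that by (simp add: power_divide)
    finally show ?thesis .
  qed
  have "(\<integral>z. norm (z :: real ^ 'd) ^ 4 \<partial>gaussian t) \<le> (\<integral>z. ?S z \<partial>gaussian t)"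
    by (intro integral_mono I S norm_power4_le)
  also have "\<dots> = real CARD('d) * (\<Sum>b\<in>(Basis :: (real ^ 'd) set). \<integral>z. (b \<bullet> z) ^ 4 \<partial>gaussian t)"
    using integrable_gaussian_moments(2)[OF t]
    by (subst integral_mult_right_zero, subst Bochner_Integration.integral_sum) auto
  also have "\<dots> \<le> real CARD('d) * (\<Sum>b\<in>(Basis :: (real ^ 'd) set). 24 * t\<^sup>2 * exp (1 / 2))"
    by (intro mult_left_mono sum_mono b) auto
  also have "\<dots> = quartic_const TYPE('d) * t\<^sup>2"
    by (simp add: quartic_const_def power2_eq_square)
  finally show "(\<integral>z. norm (z :: real ^ 'd) ^ 4 \<partial>gaussian t) \<le> quartic_const TYPE('d) * t\<^sup>2" .
qed

text \<open>Either \<open>norm z\<close> is at most \<open>sqrt t\<close>, or it is at most \<open>norm z ^ 4 / (sqrt t) ^ 3\<close>; so the fourth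
  moment bounds the first one with the right scaling in \<open>t\<close>.\<close>

lemma
  assumes t: "t > 0"
  shows integrable_gaussian_norm: "integrable (gaussian t) (\<lambda>z :: real ^ 'd::finite. norm z)"
    and gaussian_first_moment:
      "(\<integral>z. norm (z :: real ^ 'd) \<partial>gaussian t) \<le> (1 + quartic_const TYPE('d)) * sqrt t"
proof -
  interpret prob_space "gaussian t :: (real ^ 'd) measure" by (rule prob_space_gaussian) fact
  have s: "sqrt t > 0" using t by simp
  have le: "norm z \<le> sqrt t + norm z ^ 4 / (sqrt t) ^ 3" for z :: "real ^ 'd"
  proof (cases "norm z \<le> sqrt t")
    case True
    moreover have "0 \<le> norm z ^ 4 / (sqrt t) ^ 3" using s by simp
    ultimately show ?thesis by linarith
  next
    case False
    then have "norm z * (sqrt t) ^ 3 \<le> norm z * norm z ^ 3"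
      using s by (intro mult_left_mono power_mono) auto
    then have "norm z \<le> norm z ^ 4 / (sqrt t) ^ 3"
      using s by (simp add: pos_le_divide_eq power4_eq_xxxx power3_eq_cube mult.assoc)
    then show ?thesis using s by linarith
  qed
  have I: "integrable (gaussian t) (\<lambda>z :: real ^ 'd. sqrt t + norm z ^ 4 / (sqrt t) ^ 3)"
    using integrable_gaussian_norm4[OF t, where 'd='d] by simp
  show J: "integrable (gaussian t) (\<lambda>z :: real ^ 'd. norm z)"
    by (rule Bochner_Integration.integrable_bound[OF I]) (auto intro!: AE_I2 order_trans[OF le] abs_ge_self)
  have "(\<integral>z. norm (z :: real ^ 'd) \<partial>gaussian t) \<le> (\<integral>z. sqrt t + norm (z :: real ^ 'd) ^ 4 / (sqrt t) ^ 3 \<partial>gaussian t)"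
    by (intro integral_mono I J le)
  also have "\<dots> = sqrt t + (\<integral>z. norm (z :: real ^ 'd) ^ 4 \<partial>gaussian t) / (sqrt t) ^ 3"
    using integrable_gaussian_norm4[OF t, where 'd='d] by (simp add: prob_space[simplified])
  also have "\<dots> \<le> sqrt t + quartic_const TYPE('d) * t\<^sup>2 / (sqrt t) ^ 3"
    using gaussian_fourth_moment[OF t, where 'd='d] s by (intro add_left_mono divide_right_mono) auto
  also have "t\<^sup>2 = sqrt t * (sqrt t) ^ 3"
    using t by (simp add: power2_eq_square power3_eq_cube)
  also have "sqrt t + quartic_const TYPE('d) * (sqrt t * (sqrt t) ^ 3) / (sqrt t) ^ 3 = (1 + quartic_const TYPE('d)) * sqrt t"
    using s by (simp add: algebra_simps)
  finally show "(\<integral>z. norm (z :: real ^ 'd) \<partial>gaussian t) \<le> (1 + quartic_const TYPE('d)) * sqrt t" .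
qed

section \<open>The heat semigroup\<close>

definition heat :: "real \<Rightarrow> (real ^ 'd::finite \<Rightarrow> 'b::{banach, second_countable_topology}) \<Rightarrow> real ^ 'd \<Rightarrow> 'b" where
  "heat t f x = (\<integral>z. f (x + z) \<partial>gaussian t)"

lemma borel_measurable_heat [measurable]:
  assumes [measurable]: "f \<in> borel_measurable borel" and "t > 0"
  shows "heat t f \<in> borel_measurable borel"
proof -
  interpret prob_space "gaussian t" by (rule prob_space_gaussian) fact
  show ?thesis unfolding heat_def[abs_def] by measurable
qed

lemma integrable_gaussian_bounded:
  fixes f :: "real ^ 'd::finite \<Rightarrow> 'b::{banach, second_countable_topology}"
  assumes "t > 0" and [measurable]: "f \<in> borel_measurable borel" and "\<And>x. norm (f x) \<le> B"
  shows "integrable (gaussian t) (\<lambda>z. f (x + z))"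
proof -
  interpret prob_space "gaussian t" by (rule prob_space_gaussian) fact
  show ?thesis by (rule integrable_const_bound[of _ B]) (auto simp: assms)
qed

lemma heat_const [simp]:
  fixes x :: "real ^ 'd::finite"
  shows "t > 0 \<Longrightarrow> heat t (\<lambda>_. c) x = c"
  using prob_space.prob_space[OF prob_space_gaussian[where 'a='d], of t] by (simp add: heat_def)

lemma heat_mono:
  fixes f g :: "real ^ 'd::finite \<Rightarrow> real"
  assumes "t > 0" "f \<in> borel_measurable borel" "g \<in> borel_measurable borel"
    and "\<And>x. \<bar>f x\<bar> \<le> A" "\<And>x. \<bar>g x\<bar> \<le> B" "\<And>x. f x \<le> g x"
  shows "heat t f x \<le> heat t g x"
  unfolding heat_def
  by (intro integral_mono integrable_gaussian_bounded[of _ _ A] integrable_gaussian_bounded[of _ _ B])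
     (use assms in auto)

lemma heat_norm_le:
  fixes f :: "real ^ 'd::finite \<Rightarrow> 'b::{banach, second_countable_topology}"
  assumes "t > 0" and [measurable]: "f \<in> borel_measurable borel" and "\<And>x. norm (f x) \<le> B"
  shows "norm (heat t f x) \<le> B"
proof -
  interpret prob_space "gaussian t :: (real ^ 'd) measure" by (rule prob_space_gaussian) fact
  have "norm (heat t f x) \<le> (\<integral>z. norm (f (x + z)) \<partial>gaussian t)"
    unfolding heat_def by (rule integral_norm_bound)
  also have "\<dots> \<le> (\<integral>z. B \<partial>(gaussian t :: (real ^ 'd) measure))"
    using integrable_gaussian_bounded[OF assms] by (intro integral_mono) (auto simp: assms)
  finally show ?thesis by (simp add: prob_space[simplified])
qed

lemma heat_bounds:
  fixes f :: "real ^ 'd::finite \<Rightarrow> real"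
  assumes "t > 0" and [measurable]: "f \<in> borel_measurable borel" and f: "\<And>x. f x \<in> {a..b}"
  shows "heat t f x \<in> {a..b}"
proof -
  have B: "\<bar>f x\<bar> \<le> max \<bar>a\<bar> \<bar>b\<bar>" for x using f[of x] by auto
  have "heat t (\<lambda>_. a) x \<le> heat t f x" "heat t f x \<le> heat t (\<lambda>_. b) x"
    using f by (auto intro!: heat_mono[OF \<open>t > 0\<close>] B)
  then show ?thesis using \<open>t > 0\<close> by simp
qed

lemma integral_convolution:
  fixes f :: "'a::ordered_euclidean_space \<Rightarrow> real"
  assumes M: "prob_space M" "sets M = sets borel" and N: "prob_space N" "sets N = sets borel"
    and [measurable]: "f \<in> borel_measurable borel" and B: "\<And>x. \<bar>f x\<bar> \<le> B"
  shows "(\<integral>x. f x \<partial>convolution M N) = (\<integral>x. \<integral>y. f (x + y) \<partial>N \<partial>M)"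
proof -
  interpret M: prob_space M by fact
  interpret N: prob_space N by fact
  interpret pair_prob_space M N ..
  note [measurable_cong] = M(2) N(2)
  have "(\<integral>x. f x \<partial>convolution M N) = (\<integral>p. f (case p of (x, y) \<Rightarrow> x + y) \<partial>(M \<Otimes>\<^sub>M N))"
    unfolding convolution_def by (rule integral_distr) measurable
  also have "\<dots> = (\<integral>(x, y). f (x + y) \<partial>(M \<Otimes>\<^sub>M N))"
    by (simp add: case_prod_unfold)
  also have "\<dots> = (\<integral>x. \<integral>y. f (x + y) \<partial>N \<partial>M)"
    by (rule integral_fst[symmetric]) (auto intro!: integrable_const_bound[of _ B] simp: B)
  finally show ?thesis .
qed

text \<open>The semigroup property, from the convolution formula for Gaussian measures.\<close>

lemma heat_heat:
  fixes f :: "real ^ 'd::finite \<Rightarrow> real"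
  assumes "s > 0" "t > 0" and [measurable]: "f \<in> borel_measurable borel" and "\<And>x. \<bar>f x\<bar> \<le> B"
  shows "heat s (heat t f) x = heat (s + t) f x"
proof -
  have "heat (s + t) f x = (\<integral>z. f (x + z) \<partial>convolution (gaussian s) (gaussian t))"
    by (simp add: heat_def convolution_gaussian assms)
  also have "\<dots> = (\<integral>y. \<integral>z. f (x + (y + z)) \<partial>gaussian t \<partial>gaussian s)"
    by (rule integral_convolution[where B = B]) (auto simp: assms prob_space_gaussian)
  finally show ?thesis by (simp add: heat_def add.assoc)
qed

section \<open>Entropy inequalities along the heat semigroup\<close>

text \<open>Over a short time \<open>t\<close> the increment is close to the linear form \<open>v \<bullet> z\<close>, whose mean square is at most
  \<open>t (norm v)\<^sup>2\<close>. The quadratic remainder has mean square of order \<open>t\<^sup>2\<close>; splitting the square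
  with weight \<open>sqrt t\<close> makes the total error of order \<open>t sqrt t\<close>, so that \<open>n\<close> steps of length \<open>1 / n\<close>
  accumulate an error tending to zero.\<close>

lemma gaussian_square_increment:
  fixes g :: "real ^ 'd::finite \<Rightarrow> real"
  assumes t: "0 < t" "t \<le> 1" and [measurable]: "g \<in> borel_measurable borel"
    and B: "\<And>y. \<bar>g y\<bar> \<le> B" and v: "norm v \<le> L"
    and taylor: "\<And>z. \<bar>g (x + z) - g x - v \<bullet> z\<bar> \<le> M * (norm z)\<^sup>2"
  shows "(\<integral>z. (g (x + z) - g x)\<^sup>2 \<partial>gaussian t)
       \<le> t * (norm v)\<^sup>2 + (L\<^sup>2 + 2 * M\<^sup>2 * quartic_const TYPE('d)) * (t * sqrt t)"
proof -
  interpret prob_space "gaussian t :: (real ^ 'd) measure" by (rule prob_space_gaussian) (rule t)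
  let ?s = "sqrt t" and ?Q = "quartic_const TYPE('d)"
  have s: "?s > 0" "?s \<le> 1" using t by auto
  have B0: "0 \<le> B" using B[of x] by linarith
  have Q0: "0 \<le> ?Q" by (simp add: quartic_const_def)
  have I: "integrable (gaussian t) (\<lambda>z. (g (x + z) - g x)\<^sup>2)"
  proof (rule integrable_const_bound[of _ "(2 * B)\<^sup>2"])
    have "\<bar>g (x + z) - g x\<bar> \<le> 2 * B" for z using B[of "x + z"] B[of x] by linarith
    then show "AE z in gaussian t. norm ((g (x + z) - g x)\<^sup>2) \<le> (2 * B)\<^sup>2"
      using B0 by (intro AE_I2) (simp only: real_norm_def abs_power2, subst power2_le_iff_abs_le, auto)
  qed measurable
  have J: "integrable (gaussian t) (\<lambda>z. (1 + ?s) * (v \<bullet> z)\<^sup>2 + (1 + 1 / ?s) * M\<^sup>2 * norm z ^ 4)"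
    using integrable_gaussian_moments(1)[OF t(1), of v] integrable_gaussian_norm4[OF t(1), where 'd='d] by simp
  have le: "(g (x + z) - g x)\<^sup>2 \<le> (1 + ?s) * (v \<bullet> z)\<^sup>2 + (1 + 1 / ?s) * M\<^sup>2 * norm z ^ 4" for z
  proof -
    define a where "a = v \<bullet> z"
    define b where "b = g (x + z) - g x - v \<bullet> z"
    \<comment> \<open>the weight \<open>sqrt t\<close> balances the two error terms\<close>
    have "0 \<le> (?s * a - b)\<^sup>2 / ?s" using s by simp
    also have "(?s * a - b)\<^sup>2 / ?s = ?s * a\<^sup>2 - 2 * a * b + b\<^sup>2 / ?s"
      using s by (simp add: power2_diff power_mult_distrib field_simps power2_eq_square)
    finally have ab: "(a + b)\<^sup>2 \<le> (1 + ?s) * a\<^sup>2 + (1 + 1 / ?s) * b\<^sup>2"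
      by (simp add: power2_sum algebra_simps)
    have "\<bar>b\<bar> \<le> M * (norm z)\<^sup>2" using taylor[of z] by (simp add: b_def)
    then have "b\<^sup>2 \<le> (M * (norm z)\<^sup>2)\<^sup>2"
      by (metis abs_ge_zero power2_abs power_mono)
    then have "(1 + 1 / ?s) * b\<^sup>2 \<le> (1 + 1 / ?s) * (M * (norm z)\<^sup>2)\<^sup>2"
      using s by (intro mult_left_mono) auto
    with ab have "(a + b)\<^sup>2 \<le> (1 + ?s) * a\<^sup>2 + (1 + 1 / ?s) * (M * (norm z)\<^sup>2)\<^sup>2"
      by linarith
    then show ?thesis by (simp add: a_def b_def power_mult_distrib mult.assoc)
  qed
  have "(\<integral>z. (g (x + z) - g x)\<^sup>2 \<partial>gaussian t)
      \<le> (\<integral>z. (1 + ?s) * (v \<bullet> z)\<^sup>2 + (1 + 1 / ?s) * M\<^sup>2 * norm z ^ 4 \<partial>gaussian t)"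
    by (intro integral_mono I J le)
  also have "\<dots> = (1 + ?s) * (\<integral>z. (v \<bullet> z)\<^sup>2 \<partial>gaussian t)
      + (1 + 1 / ?s) * M\<^sup>2 * (\<integral>z. norm (z :: real ^ 'd) ^ 4 \<partial>gaussian t)"
    using integrable_gaussian_moments(1)[OF t(1), of v] integrable_gaussian_norm4[OF t(1), where 'd='d] by simp
  also have "\<dots> \<le> (1 + ?s) * (t * (norm v)\<^sup>2) + (1 + 1 / ?s) * M\<^sup>2 * (?Q * t\<^sup>2)"
    using s by (intro add_mono mult_left_mono gaussian_second_moment gaussian_fourth_moment t) auto
  also have "\<dots> = t * (norm v)\<^sup>2 + (t * ?s) * (norm v)\<^sup>2 + M\<^sup>2 * ?Q * ((1 + 1 / ?s) * t\<^sup>2)"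
    by (simp add: algebra_simps)
  also have "(t * ?s) * (norm v)\<^sup>2 \<le> (t * ?s) * L\<^sup>2"
    using t v by (intro mult_left_mono power_mono) auto
  also have "M\<^sup>2 * ?Q * ((1 + 1 / ?s) * t\<^sup>2) \<le> M\<^sup>2 * ?Q * (2 * (t * ?s))"
  proof (rule mult_left_mono)
    have "(1 + 1 / ?s) * t\<^sup>2 = (?s * ?s + ?s) * t"
      using t s by (simp add: field_simps power2_eq_square)
    also have "\<dots> \<le> (?s + ?s) * t"
      using t s by (intro mult_right_mono add_right_mono) (auto simp: mult_left_le simp del: real_sqrt_mult_self)
    finally show "(1 + 1 / ?s) * t\<^sup>2 \<le> 2 * (t * ?s)" by (simp add: mult_ac)
  qed (use Q0 in auto)
  finally show ?thesis by (simp add: algebra_simps)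
qed

lemma heat_linear_combination:
  fixes f g :: "real ^ 'd::finite \<Rightarrow> real"
  assumes "t > 0" "f \<in> borel_measurable borel" "g \<in> borel_measurable borel"
    and "\<And>x. \<bar>f x\<bar> \<le> A" "\<And>x. \<bar>g x\<bar> \<le> B"
  shows "heat t (\<lambda>y. f y + (a * g y + b)) x = heat t f x + (a * heat t g x + b)"
proof -
  interpret prob_space "gaussian t :: (real ^ 'd) measure" by (rule prob_space_gaussian) fact
  have [simp]: "integrable (gaussian t) (\<lambda>z. f (x + z))" "integrable (gaussian t) (\<lambda>z. g (x + z))"
    by (rule integrable_gaussian_bounded[of _ _ A], use assms in auto)
       (rule integrable_gaussian_bounded[of _ _ B], use assms in auto)
  show ?thesis by (simp add: heat_def prob_space[simplified])
qed

text \<open>A common frame for variance and entropy. For a convex \<open>\<Phi>\<close> with derivative \<open>D\<close>, the defect in Jensen's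
  inequality is at most the mean Bregman divergence from any base point \<open>c\<close>, and that divergence is
  assumed to be at most \<open>(u - c)\<^sup>2\<close> divided by a weight. The weight is affine, \<open>\<alpha> + \<beta> c\<close>, because an affine
  function commutes with averaging. The variance is \<open>\<Phi> u = u\<^sup>2\<close> with weight \<open>1\<close>; the entropy is
  \<open>\<Phi> u = u ln u\<close> with weight \<open>c\<close>, on an interval of positive numbers.\<close>

locale dominated_bregman =
  fixes \<Phi> D :: "real \<Rightarrow> real" and lo hi \<alpha> \<beta> w :: real
  assumes measurable_fun: "\<Phi> \<in> borel_measurable borel"
    and w_pos: "0 < w"
    and weight: "\<And>c. c \<in> {lo..hi} \<Longrightarrow> w \<le> \<alpha> + \<beta> * c"
    and bregman_nonneg: "\<And>u c. u \<in> {lo..hi} \<Longrightarrow> c \<in> {lo..hi} \<Longrightarrow> 0 \<le> \<Phi> u - \<Phi> c - D c * (u - c)"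
    and bregman_le: "\<And>u c. u \<in> {lo..hi} \<Longrightarrow> c \<in> {lo..hi} \<Longrightarrow>
          \<Phi> u - \<Phi> c - D c * (u - c) \<le> (u - c)\<^sup>2 / (\<alpha> + \<beta> * c)"
begin

lemma bounded_fun:
  obtains B where "\<And>u. u \<in> {lo..hi} \<Longrightarrow> \<bar>\<Phi> u\<bar> \<le> B"
proof
  fix u assume u: "u \<in> {lo..hi}"
  then have lo: "lo \<in> {lo..hi}" by auto
  have "\<bar>D lo * (u - lo)\<bar> \<le> \<bar>D lo\<bar> * (hi - lo)"
    using u by (simp add: abs_mult mult_left_mono)
  moreover have "(u - lo)\<^sup>2 / (\<alpha> + \<beta> * lo) \<le> (hi - lo)\<^sup>2 / w"
    using u weight[OF lo] w_pos by (intro frac_le power_mono) auto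
  moreover have "0 \<le> (hi - lo)\<^sup>2 / w" using w_pos by simp
  ultimately show "\<bar>\<Phi> u\<bar> \<le> \<bar>\<Phi> lo\<bar> + \<bar>D lo\<bar> * (hi - lo) + (hi - lo)\<^sup>2 / w"
    using bregman_nonneg[OF u lo] bregman_le[OF u lo] by linarith
qed

text \<open>Here \<open>V\<close> plays the role of the gradient of \<open>g\<close>, and \<open>F\<close> of an upper bound for \<open>(norm V)\<^sup>2\<close> divided by
  the weight at \<open>g\<close>. That bound is stated as the family of its tangent inequalities, one for each vector \<open>a\<close>:
  in this form every condition is a bound on a quantity linear in \<open>(g, V, F)\<close> and is therefore inherited by
  averages. This replaces both differentiation under the integral and the Cauchy-Schwarz inequality.\<close>

definition controlled ::
  "real \<Rightarrow> real \<Rightarrow> real \<Rightarrow> real \<Rightarrow> (real ^ 'd::finite \<Rightarrow> real) \<Rightarrow> (real ^ 'd \<Rightarrow> real ^ 'd) \<Rightarrow> (real ^ 'd \<Rightarrow> real) \<Rightarrow> bool" where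
  "controlled L M K B g V F \<longleftrightarrow>
     g \<in> borel_measurable borel \<and> V \<in> borel_measurable borel \<and> F \<in> borel_measurable borel \<and>
     (\<forall>x. g x \<in> {lo..hi}) \<and> (\<forall>x. norm (V x) \<le> L) \<and> (\<forall>x. \<bar>F x\<bar> \<le> B) \<and>
     (\<forall>x z. \<bar>g (x + z) - g x - V x \<bullet> z\<bar> \<le> M * (norm z)\<^sup>2) \<and>
     (\<forall>x z. \<bar>F (x + z) - F x\<bar> \<le> K * norm z) \<and>
     (\<forall>x a. 2 * (a \<bullet> V x) \<le> (norm a)\<^sup>2 * (\<alpha> + \<beta> * g x) + F x)"

lemma controlledD:
  assumes "controlled L M K B g V F"
  shows "g \<in> borel_measurable borel" "V \<in> borel_measurable borel" "F \<in> borel_measurable borel"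
    and "g x \<in> {lo..hi}" "norm (V x) \<le> L" "\<bar>F x\<bar> \<le> B"
    and "\<bar>g (x + z) - g x - V x \<bullet> z\<bar> \<le> M * (norm z)\<^sup>2"
    and "\<bar>F (x + z) - F x\<bar> \<le> K * norm z"
    and "2 * (a \<bullet> V x) \<le> (norm a)\<^sup>2 * (\<alpha> + \<beta> * g x) + F x"
    and "\<bar>g x\<bar> \<le> max \<bar>lo\<bar> \<bar>hi\<bar>"
proof -
  show "g x \<in> {lo..hi}" using assms by (simp add: controlled_def)
  then show "\<bar>g x\<bar> \<le> max \<bar>lo\<bar> \<bar>hi\<bar>" by auto
qed (use assms in \<open>auto simp: controlled_def\<close>)

lemma controlled_heat:
  fixes g :: "real ^ 'd::finite \<Rightarrow> real"
  assumes t: "t > 0" and c: "controlled L M K B g V F"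
  shows "controlled L M K B (heat t g) (heat t V) (heat t F)"
proof -
  interpret prob_space "gaussian t :: (real ^ 'd) measure" by (rule prob_space_gaussian) fact
  note c' = controlledD[OF c]
  note [measurable] = c'(1-3)
  have I: "integrable (gaussian t) (\<lambda>z. g (x + z))" "integrable (gaussian t) (\<lambda>z. V (x + z))"
    "integrable (gaussian t) (\<lambda>z. F (x + z))" for x
    using integrable_gaussian_bounded[OF t c'(1)] integrable_gaussian_bounded[OF t c'(2)]
      integrable_gaussian_bounded[OF t c'(3)] c'(5,6,10) unfolding real_norm_def by blast+
  have inner: "a \<bullet> heat t V x = (\<integral>z. a \<bullet> V (x + z) \<partial>gaussian t)" for a x
    unfolding heat_def by (rule integral_inner_right[symmetric]) (rule I)
  have avg: "\<bar>\<integral>y. h y \<partial>(gaussian t :: (real ^ 'd) measure)\<bar> \<le> b"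
    if "integrable (gaussian t) h" "\<And>y. \<bar>h y\<bar> \<le> b" for h :: "real ^ 'd \<Rightarrow> real" and b
  proof -
    have "\<bar>\<integral>y. h y \<partial>(gaussian t :: (real ^ 'd) measure)\<bar> \<le> (\<integral>y. \<bar>h y\<bar> \<partial>gaussian t)"
      using integral_norm_bound[of "gaussian t" h] by simp
    also have "\<dots> \<le> (\<integral>y. b \<partial>(gaussian t :: (real ^ 'd) measure))"
      using that by (intro integral_mono) auto
    finally show ?thesis by (simp add: prob_space[simplified])
  qed
  show ?thesis unfolding controlled_def
  proof (intro conjI allI)
    show "heat t g \<in> borel_measurable borel" "heat t V \<in> borel_measurable borel"
      "heat t F \<in> borel_measurable borel" using t by measurable
    fix x
    show "heat t g x \<in> {lo..hi}" by (rule heat_bounds[OF t]) (auto simp: c' simp del: atLeastAtMost_iff)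
    show "norm (heat t V x) \<le> L" by (rule heat_norm_le[OF t]) (auto simp: c')
    show "\<bar>heat t F x\<bar> \<le> B" using heat_norm_le[OF t, of F B x] c' by auto
    show "2 * (a \<bullet> heat t V x) \<le> (norm a)\<^sup>2 * (\<alpha> + \<beta> * heat t g x) + heat t F x" for a
    proof -
      have "2 * (a \<bullet> heat t V x) = (\<integral>z. 2 * (a \<bullet> V (x + z)) \<partial>gaussian t)" by (simp add: inner)
      also have "\<dots> \<le> (\<integral>z. (norm a)\<^sup>2 * (\<alpha> + \<beta> * g (x + z)) + F (x + z) \<partial>gaussian t)"
        using I by (intro integral_mono c'(9)) auto
      also have "\<dots> = (norm a)\<^sup>2 * (\<alpha> + \<beta> * heat t g x) + heat t F x"
        using I by (simp add: heat_def prob_space[simplified])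
      finally show ?thesis .
    qed
    fix z
    have eq: "heat t g (x + z) - heat t g x - heat t V x \<bullet> z
        = (\<integral>y. g ((x + y) + z) - g (x + y) - V (x + y) \<bullet> z \<partial>gaussian t)"
      using I[of "x + z"] I[of x] by (simp add: heat_def inner[unfolded heat_def] inner_commute ac_simps)
    have "integrable (gaussian t) (\<lambda>y. g ((x + y) + z) - g (x + y) - V (x + y) \<bullet> z)"
      using I[of "x + z"] I[of x] by (auto simp: ac_simps)
    then show "\<bar>heat t g (x + z) - heat t g x - heat t V x \<bullet> z\<bar> \<le> M * (norm z)\<^sup>2"
      unfolding eq by (rule avg) (rule c'(7))
    have eq': "heat t F (x + z) - heat t F x = (\<integral>y. F ((x + y) + z) - F (x + y) \<partial>gaussian t)"
      using I[of "x + z"] I[of x] by (simp add: heat_def ac_simps)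
    have "integrable (gaussian t) (\<lambda>y. F ((x + y) + z) - F (x + y))"
      using I[of "x + z"] I[of x] by (auto simp: ac_simps)
    then show "\<bar>heat t F (x + z) - heat t F x\<bar> \<le> K * norm z"
      unfolding eq' by (rule avg) (rule c'(8))
  qed
qed

text \<open>The coefficient of \<open>t sqrt t\<close> in the error of one time step. The first term comes from the mean square
  of the increment, the second from moving \<open>F\<close> from the starting point to its average.\<close>

definition step_error :: "'d::finite itself \<Rightarrow> real \<Rightarrow> real \<Rightarrow> real \<Rightarrow> real" where
  "step_error d L M K = (L\<^sup>2 + 2 * M\<^sup>2 * quartic_const d) / w + K * (1 + quartic_const d)"

text \<open>One short step: Jensen's defect is estimated by the Bregman divergence from the value \<open>g x\<close> at the
  starting point, hence by the mean square of the increment divided by the weight there.\<close>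

lemma heat_step:
  fixes g :: "real ^ 'd::finite \<Rightarrow> real"
  assumes t: "0 < t" "t \<le> 1" and K: "0 \<le> K" and c: "controlled L M K B g V F"
  shows "heat t (\<lambda>y. \<Phi> (g y)) x - \<Phi> (heat t g x)
       \<le> t * heat t F x + step_error TYPE('d) L M K * (t * sqrt t)"
proof -
  interpret prob_space "gaussian t :: (real ^ 'd) measure" by (rule prob_space_gaussian) (rule t)
  note c' = controlledD[OF c]
  note [measurable] = c'(1-3) measurable_fun
  let ?Q = "quartic_const TYPE('d)"
  obtain A where A: "\<And>u. u \<in> {lo..hi} \<Longrightarrow> \<bar>\<Phi> u\<bar> \<le> A" using bounded_fun by blast
  have Ig: "integrable (gaussian t) (\<lambda>z. g (x + z))"
    by (rule integrable_gaussian_bounded[of _ _ "max \<bar>lo\<bar> \<bar>hi\<bar>"]) (use t c' in \<open>auto simp del: atLeastAtMost_iff\<close>)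
  have I\<Phi>: "integrable (gaussian t) (\<lambda>z. \<Phi> (g (x + z)))"
    by (rule integrable_gaussian_bounded[of _ "\<lambda>y. \<Phi> (g y)" A]) (use t A c'(4) in \<open>auto simp del: atLeastAtMost_iff\<close>)
  have IF: "integrable (gaussian t) (\<lambda>z. F (x + z))"
    by (rule integrable_gaussian_bounded[of _ _ B]) (use t c'(6) in auto)
  have I2: "integrable (gaussian t) (\<lambda>z. (g (x + z) - g x)\<^sup>2)"
  proof (rule integrable_const_bound[of _ "(hi - lo)\<^sup>2"])
    have "\<bar>g (x + z) - g x\<bar> \<le> hi - lo" for z using c'(4)[of "x + z"] c'(4)[of x] by auto
    then show "AE z in gaussian t. norm ((g (x + z) - g x)\<^sup>2) \<le> (hi - lo)\<^sup>2"
      by (intro AE_I2) (metis abs_ge_zero power2_abs power_mono real_norm_def abs_power2)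
  qed measurable
  define q where "q = \<alpha> + \<beta> * g x"
  have q: "w \<le> q" "0 < q" using weight[OF c'(4)[of x]] w_pos by (auto simp: q_def)
  have "heat t (\<lambda>y. \<Phi> (g y)) x
      \<le> (\<integral>z. \<Phi> (g x) + D (g x) * (g (x + z) - g x) + (g (x + z) - g x)\<^sup>2 / q \<partial>gaussian t)"
    unfolding heat_def
  proof (intro integral_mono I\<Phi>)
    show "integrable (gaussian t) (\<lambda>z. \<Phi> (g x) + D (g x) * (g (x + z) - g x) + (g (x + z) - g x)\<^sup>2 / q)"
      using Ig I2 by auto
    show "\<Phi> (g (x + z)) \<le> \<Phi> (g x) + D (g x) * (g (x + z) - g x) + (g (x + z) - g x)\<^sup>2 / q" for z
      using bregman_le[OF c'(4)[of "x + z"] c'(4)[of x]] by (simp add: q_def)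
  qed
  also have "\<dots> = \<Phi> (g x) + D (g x) * (heat t g x - g x) + (\<integral>z. (g (x + z) - g x)\<^sup>2 \<partial>gaussian t) / q"
    using Ig I2 by (simp add: heat_def prob_space[simplified])
  also have "\<dots> \<le> \<Phi> (heat t g x) + (\<integral>z. (g (x + z) - g x)\<^sup>2 \<partial>gaussian t) / q"
    using bregman_nonneg[OF controlledD(4)[OF controlled_heat[OF t(1) c], of x] c'(4)[of x]] by simp
  also have "(\<integral>z. (g (x + z) - g x)\<^sup>2 \<partial>gaussian t) / q
      \<le> (t * (norm (V x))\<^sup>2 + (L\<^sup>2 + 2 * M\<^sup>2 * ?Q) * (t * sqrt t)) / q"
    using q by (intro divide_right_mono gaussian_square_increment[OF t c'(1) c'(10) c'(5) c'(7)]) auto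
  also have "\<dots> = t * ((norm (V x))\<^sup>2 / q) + (L\<^sup>2 + 2 * M\<^sup>2 * ?Q) * (t * sqrt t) / q"
    by (simp add: add_divide_distrib)
  also have "\<dots> \<le> t * F x + (L\<^sup>2 + 2 * M\<^sup>2 * ?Q) * (t * sqrt t) / w"
  proof (intro add_mono mult_left_mono divide_left_mono)
    \<comment> \<open>the tangent inequality that is optimal for this \<open>V x\<close>\<close>
    have "2 * (((1 / q) *\<^sub>R V x) \<bullet> V x) \<le> (norm ((1 / q) *\<^sub>R V x))\<^sup>2 * q + F x"
      unfolding q_def by (rule c'(9))
    then show "(norm (V x))\<^sup>2 / q \<le> F x"
      using q by (simp add: power2_norm_eq_inner[symmetric] power_mult_distrib power_divide power2_eq_square)
  qed (use q w_pos t in \<open>auto simp: quartic_const_def\<close>)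
  also have "t * F x \<le> t * (heat t F x + K * ((1 + ?Q) * sqrt t))"
  proof (rule mult_left_mono)
    have "F x = (\<integral>z. F x \<partial>(gaussian t :: (real ^ 'd) measure))" by (simp add: prob_space[simplified])
    also have "\<dots> \<le> (\<integral>z. F (x + z) + K * norm z \<partial>gaussian t)"
    proof (intro integral_mono)
      show "integrable (gaussian t) (\<lambda>z. F (x + z) + K * norm z)"
        using IF integrable_gaussian_norm[OF t(1), where 'd='d] by auto
      show "F x \<le> F (x + z) + K * norm z" for z using c'(8)[of x z] by linarith
    qed simp
    also have "\<dots> = heat t F x + K * (\<integral>z. norm (z :: real ^ 'd) \<partial>gaussian t)"
      using IF integrable_gaussian_norm[OF t(1), where 'd='d] by (simp add: heat_def)
    also have "\<dots> \<le> heat t F x + K * ((1 + ?Q) * sqrt t)"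
      using K gaussian_first_moment[OF t(1), where 'd='d] by (intro add_left_mono mult_left_mono)
    finally show "F x \<le> heat t F x + K * ((1 + ?Q) * sqrt t)" .
  qed (use t in auto)
  finally show ?thesis by (simp add: step_error_def algebra_simps)
qed

text \<open>Chain rule for Jensen's defect: the defect over \<open>n + 1\<close> steps is the defect over \<open>n\<close> steps of the
  function averaged once, plus the average over \<open>n\<close> steps of the defects of a single step. Averages of
  controlled data being controlled with the same constants, the errors add up linearly.\<close>

lemma heat_steps:
  fixes g :: "real ^ 'd::finite \<Rightarrow> real"
  assumes t: "0 < t" "t \<le> 1" and K: "0 \<le> K" and "n \<ge> 1" and "controlled L M K B g V F"
  shows "heat (n * t) (\<lambda>y. \<Phi> (g y)) x - \<Phi> (heat (n * t) g x)
       \<le> (n * t) * heat (n * t) F x + real n * (step_error TYPE('d) L M K * (t * sqrt t))"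
  using assms(4,5)
proof (induction n arbitrary: g V F rule: nat_induct_at_least)
  case base
  then show ?case using heat_step[OF t K, of L M B g V F x] by simp
next
  case (Suc n)
  let ?e = "step_error TYPE('d) L M K * (t * sqrt t)" and ?s = "real n * t"
  note c = Suc.prems and c1 = controlled_heat[OF t(1) Suc.prems]
  note c' = controlledD[OF c] and c1' = controlledD[OF c1]
  note [measurable] = c'(1-3) c1'(1-3) measurable_fun
  have s: "?s > 0" using Suc.hyps t by simp
  obtain A where A: "\<And>u. u \<in> {lo..hi} \<Longrightarrow> \<bar>\<Phi> u\<bar> \<le> A" using bounded_fun by blast
  have A1: "\<bar>\<Phi> (g y)\<bar> \<le> A" "\<bar>\<Phi> (heat t g y)\<bar> \<le> A" for y
    by (intro A c'(4) c1'(4))+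
  have eq: "real (Suc n) * t = ?s + t" by (simp add: algebra_simps)
  have "heat (?s + t) (\<lambda>y. \<Phi> (g y)) x = heat ?s (heat t (\<lambda>y. \<Phi> (g y))) x"
    using heat_heat[OF s t(1), of "\<lambda>y. \<Phi> (g y)" A x] A1(1) by simp
  also have "\<dots> \<le> heat ?s (\<lambda>y. \<Phi> (heat t g y) + (t * heat t F y + ?e)) x"
  proof (rule heat_mono[OF s])
    show "\<bar>heat t (\<lambda>y. \<Phi> (g y)) y\<bar> \<le> A" for y
      using heat_norm_le[OF t(1), of "\<lambda>y. \<Phi> (g y)" A] A1(1) by simp
    show "\<bar>\<Phi> (heat t g y) + (t * heat t F y + ?e)\<bar> \<le> A + (t * B + \<bar>?e\<bar>)" for y
    proof -
      have "\<bar>t * heat t F y\<bar> \<le> t * B" using t c1'(6)[of y] by (simp add: abs_mult)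
      then show ?thesis using A1(2)[of y] by linarith
    qed
    show "heat t (\<lambda>y. \<Phi> (g y)) y \<le> \<Phi> (heat t g y) + (t * heat t F y + ?e)" for y
      using heat_step[OF t K c, of y] by linarith
  qed (use t in measurable)
  also have "\<dots> = heat ?s (\<lambda>y. \<Phi> (heat t g y)) x + (t * heat ?s (heat t F) x + ?e)"
    by (rule heat_linear_combination[OF s _ _ A1(2) c1'(6)]) measurable
  also have "heat ?s (\<lambda>y. \<Phi> (heat t g y)) x
      \<le> \<Phi> (heat ?s (heat t g) x) + (?s * heat ?s (heat t F) x + real n * ?e)"
    using Suc.IH[OF c1] by linarith
  also have "heat ?s (heat t g) x = heat (?s + t) g x"
    by (rule heat_heat[OF s t(1) c'(1) c'(10)])
  also have "heat ?s (heat t F) x = heat (?s + t) F x"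
    by (rule heat_heat[OF s t(1) c'(3) c'(6)])
  finally show ?case unfolding eq by (simp add: algebra_simps)
qed

theorem heat_entropy:
  fixes g :: "real ^ 'd::finite \<Rightarrow> real"
  assumes t: "0 < t" and K: "0 \<le> K" and c: "controlled L M K B g V F"
  shows "heat t (\<lambda>y. \<Phi> (g y)) x - \<Phi> (heat t g x) \<le> t * heat t F x"
proof -
  define e where "e = step_error TYPE('d) L M K"
  let ?lhs = "heat t (\<lambda>y. \<Phi> (g y)) x - \<Phi> (heat t g x)"
  have bound: "?lhs \<le> t * heat t F x + e * (t * sqrt (t / real n))" if n: "real n \<ge> max 1 t" for n
  proof -
    have "?lhs \<le> t * heat t F x + real n * (e * ((t / real n) * sqrt (t / real n)))"
      using heat_steps[of "t / real n" K n L M B g V F x] n t K c by (auto simp: e_def)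
    then show ?thesis using n by (auto simp: mult_ac)
  qed
  have "(\<lambda>n. t * heat t F x + e * (t * sqrt (t / real n))) \<longlonglongrightarrow> t * heat t F x + e * (t * sqrt 0)"
    by (intro tendsto_intros lim_const_over_n)
  moreover have "eventually (\<lambda>n. real n \<ge> max 1 t) sequentially"
    by (rule eventually_sequentiallyI[of "nat \<lceil>max 1 t\<rceil>"]) linarith
  then have "eventually (\<lambda>n. ?lhs \<le> t * heat t F x + e * (t * sqrt (t / real n))) sequentially"
    by eventually_elim (rule bound)
  ultimately have "?lhs \<le> t * heat t F x + e * (t * sqrt 0)"
    by (rule tendsto_lowerbound) simp
  then show ?thesis by simp
qed

end

section \<open>Poincare and log-Sobolev inequalities for Gaussian averages\<close>

text \<open>All that is used of a test function \<open>f\<close> with gradient \<open>V\<close>: both are bounded and Lipschitz, and the Taylor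
  remainder of first order is quadratic, uniformly in the base point.\<close>

definition bounded_C11 :: "(real ^ 'd::finite \<Rightarrow> real) \<Rightarrow> (real ^ 'd \<Rightarrow> real ^ 'd) \<Rightarrow> bool" where
  "bounded_C11 f V \<longleftrightarrow> f \<in> borel_measurable borel \<and> V \<in> borel_measurable borel \<and>
     (\<exists>A L M. 0 \<le> L \<and> 0 \<le> M \<and> (\<forall>x. \<bar>f x\<bar> \<le> A \<and> norm (V x) \<le> L) \<and>
       (\<forall>x z. \<bar>f (x + z) - f x\<bar> \<le> L * norm z \<and> norm (V (x + z) - V x) \<le> M * norm z \<and>
              \<bar>f (x + z) - f x - V x \<bullet> z\<bar> \<le> M * (norm z)\<^sup>2))"

lemma bounded_C11E:
  assumes "bounded_C11 f V"
  obtains A L M where "0 \<le> A" "0 \<le> L" "0 \<le> M"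
    "f \<in> borel_measurable borel" "V \<in> borel_measurable borel"
    "\<And>x. \<bar>f x\<bar> \<le> A" "\<And>x. norm (V x) \<le> L"
    "\<And>x z. \<bar>f (x + z) - f x\<bar> \<le> L * norm z" "\<And>x z. norm (V (x + z) - V x) \<le> M * norm z"
    "\<And>x z. \<bar>f (x + z) - f x - V x \<bullet> z\<bar> \<le> M * (norm z)\<^sup>2"
proof -
  from assms obtain A L M where *: "0 \<le> L" "0 \<le> M"
    "f \<in> borel_measurable borel" "V \<in> borel_measurable borel"
    "\<And>x. \<bar>f x\<bar> \<le> A" "\<And>x. norm (V x) \<le> L"
    "\<And>x z. \<bar>f (x + z) - f x\<bar> \<le> L * norm z" "\<And>x z. norm (V (x + z) - V x) \<le> M * norm z"
    "\<And>x z. \<bar>f (x + z) - f x - V x \<bullet> z\<bar> \<le> M * (norm z)\<^sup>2"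
    unfolding bounded_C11_def by blast
  moreover have "0 \<le> A" using *(5)[of 0] by linarith
  ultimately show thesis using that by blast
qed

lemma norm_power2_lipschitz:
  fixes a b :: "'a::real_inner"
  assumes "norm a \<le> L" "norm b \<le> L" "norm (b - a) \<le> d"
  shows "\<bar>(norm b)\<^sup>2 - (norm a)\<^sup>2\<bar> \<le> 2 * L * d"
proof -
  have "(norm b)\<^sup>2 - (norm a)\<^sup>2 = (norm b + norm a) * (norm b - norm a)"
    by (simp add: power2_eq_square algebra_simps)
  moreover have "\<bar>norm b - norm a\<bar> \<le> d" using assms(3) norm_triangle_ineq3[of b a] by linarith
  moreover have "\<bar>norm b + norm a\<bar> \<le> 2 * L" using assms by simp
  ultimately show ?thesis
    using order_trans[OF norm_ge_zero assms(1)] by (simp only: abs_mult) (intro mult_mono, auto)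
qed

theorem heat_poincare:
  fixes f :: "real ^ 'd::finite \<Rightarrow> real"
  assumes t: "t > 0" and f: "bounded_C11 f V"
  shows "heat t (\<lambda>y. (f y)\<^sup>2) x - (heat t f x)\<^sup>2 \<le> t * heat t (\<lambda>y. (norm (V y))\<^sup>2) x"
proof -
  from f obtain A L M where c: "0 \<le> A" "0 \<le> L" "0 \<le> M"
    and [measurable]: "f \<in> borel_measurable borel" "V \<in> borel_measurable borel"
    and b: "\<And>x. \<bar>f x\<bar> \<le> A" "\<And>x. norm (V x) \<le> L"
      "\<And>x z. \<bar>f (x + z) - f x\<bar> \<le> L * norm z" "\<And>x z. norm (V (x + z) - V x) \<le> M * norm z"
      "\<And>x z. \<bar>f (x + z) - f x - V x \<bullet> z\<bar> \<le> M * (norm z)\<^sup>2"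
    by (rule bounded_C11E) blast
  interpret dominated_bregman "\<lambda>u. u\<^sup>2" "\<lambda>c. 2 * c" "- A" A 1 0 1
  proof
    have eq: "u\<^sup>2 - c\<^sup>2 - 2 * c * (u - c) = (u - c)\<^sup>2" for u c :: real
      by (simp add: power2_eq_square algebra_simps)
    show "0 \<le> u\<^sup>2 - c\<^sup>2 - 2 * c * (u - c)" "u\<^sup>2 - c\<^sup>2 - 2 * c * (u - c) \<le> (u - c)\<^sup>2 / (1 + 0 * c)" for u c :: real
      unfolding eq by simp_all
  qed auto
  have "controlled L M (2 * L * M) (L\<^sup>2) f V (\<lambda>y. (norm (V y))\<^sup>2)"
    unfolding controlled_def
  proof (intro conjI allI)
    fix x show "f x \<in> {- A..A}" using b(1)[of x] by auto
    show "\<bar>(norm (V x))\<^sup>2\<bar> \<le> L\<^sup>2" using b(2)[of x] by (simp add: power_mono)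
    show "2 * (a \<bullet> V x) \<le> (norm a)\<^sup>2 * (1 + 0 * f x) + (norm (V x))\<^sup>2" for a
      using inner_ge_zero[of "a - V x"]
      by (simp add: power2_norm_eq_inner inner_diff_left inner_diff_right inner_commute)
    show "\<bar>(norm (V (x + z)))\<^sup>2 - (norm (V x))\<^sup>2\<bar> \<le> 2 * L * M * norm z" for z
      using norm_power2_lipschitz[OF b(2) b(2) b(4)] by (simp add: mult.assoc)
  qed (use b in auto)
  from heat_entropy[OF t _ this, of x] c show ?thesis by simp
qed

lemma x_ln_x_bregman:
  fixes u c :: real
  assumes "0 < u" "0 < c"
  shows "0 \<le> u * ln u - c * ln c - (ln c + 1) * (u - c)"
    and "u * ln u - c * ln c - (ln c + 1) * (u - c) \<le> (u - c)\<^sup>2 / c"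
proof -
  have eq: "u * ln u - c * ln c - (ln c + 1) * (u - c) = u * (ln u - ln c) - u + c"
    by (simp add: algebra_simps)
  have "u * (ln c - ln u) \<le> u * ((c - u) / u)"
    using assms by (intro mult_left_mono ln_diff_le) auto
  also have "u * ((c - u) / u) = c - u" using assms by simp
  finally show "0 \<le> u * ln u - c * ln c - (ln c + 1) * (u - c)"
    unfolding eq using assms by (simp add: algebra_simps)
  have "u * (ln u - ln c) \<le> u * ((u - c) / c)"
    using assms by (intro mult_left_mono ln_diff_le) auto
  also have "u * ((u - c) / c) = (u - c)\<^sup>2 / c + u - c"
    using assms by (simp add: field_simps power2_eq_square)
  finally show "u * ln u - c * ln c - (ln c + 1) * (u - c) \<le> (u - c)\<^sup>2 / c"
    unfolding eq by simp
qed

text \<open>The shift keeps \<open>f\<^sup>2 + e\<close> away from zero, where the weight of \<open>u ln u\<close> degenerates. The gradient of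
  \<open>f\<^sup>2 + e\<close> is \<open>2 f V\<close>, whose square is at most \<open>4 (norm V)\<^sup>2\<close> times \<open>f\<^sup>2 + e\<close>; this explains the choice
  \<open>F = 4 (norm V)\<^sup>2\<close>, which does not depend on \<open>e\<close>.\<close>

lemma heat_log_sobolev_shifted:
  fixes f :: "real ^ 'd::finite \<Rightarrow> real"
  assumes t: "t > 0" and f: "bounded_C11 f V" and e: "e > 0"
  shows "heat t (\<lambda>y. ((f y)\<^sup>2 + e) * ln ((f y)\<^sup>2 + e)) x
           - heat t (\<lambda>y. (f y)\<^sup>2 + e) x * ln (heat t (\<lambda>y. (f y)\<^sup>2 + e) x)
       \<le> 4 * t * heat t (\<lambda>y. (norm (V y))\<^sup>2) x"
proof -
  from f obtain A L M where c: "0 \<le> A" "0 \<le> L" "0 \<le> M"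
    and [measurable]: "f \<in> borel_measurable borel" "V \<in> borel_measurable borel"
    and b: "\<And>x. \<bar>f x\<bar> \<le> A" "\<And>x. norm (V x) \<le> L"
      "\<And>x z. \<bar>f (x + z) - f x\<bar> \<le> L * norm z" "\<And>x z. norm (V (x + z) - V x) \<le> M * norm z"
      "\<And>x z. \<bar>f (x + z) - f x - V x \<bullet> z\<bar> \<le> M * (norm z)\<^sup>2"
    by (rule bounded_C11E) blast
  interpret dominated_bregman "\<lambda>u. u * ln u" "\<lambda>c. ln c + 1" e "A\<^sup>2 + e" 0 1 e
  proof
    show "(\<lambda>u::real. u * ln u) \<in> borel_measurable borel" by measurable
  qed (use e x_ln_x_bregman in auto)
  have "controlled (2 * A * L) (L\<^sup>2 + 2 * A * M) (8 * L * M) (4 * L\<^sup>2)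
     (\<lambda>y. (f y)\<^sup>2 + e) (\<lambda>y. (2 * f y) *\<^sub>R V y) (\<lambda>y. 4 * (norm (V y))\<^sup>2)"
    unfolding controlled_def
  proof (intro conjI allI)
    fix x
    have "(f x)\<^sup>2 \<le> A\<^sup>2" using b(1)[of x] by (metis abs_ge_zero power2_abs power_mono)
    then show "(f x)\<^sup>2 + e \<in> {e..A\<^sup>2 + e}" by auto
    show "norm ((2 * f x) *\<^sub>R V x) \<le> 2 * A * L"
      using b(1,2)[of x] c by (auto simp: abs_mult intro!: mult_mono)
    show "\<bar>4 * (norm (V x))\<^sup>2\<bar> \<le> 4 * L\<^sup>2" using b(2)[of x] by (simp add: power_mono)
    show "2 * (a \<bullet> ((2 * f x) *\<^sub>R V x)) \<le> (norm a)\<^sup>2 * (0 + 1 * ((f x)\<^sup>2 + e)) + 4 * (norm (V x))\<^sup>2" for a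
    proof -
      have "0 \<le> (norm (f x *\<^sub>R a - 2 *\<^sub>R V x))\<^sup>2" by simp
      also have "\<dots> = (f x)\<^sup>2 * (norm a)\<^sup>2 - 4 * f x * (a \<bullet> V x) + 4 * (norm (V x))\<^sup>2"
        unfolding power2_norm_eq_inner
        by (simp add: inner_diff_left inner_diff_right inner_commute algebra_simps power2_eq_square)
      moreover have "0 \<le> (norm a)\<^sup>2 * e" using e by simp
      ultimately show ?thesis by (simp add: algebra_simps)
    qed
    show "\<bar>4 * (norm (V (x + z)))\<^sup>2 - 4 * (norm (V x))\<^sup>2\<bar> \<le> 8 * L * M * norm z" for z
      using norm_power2_lipschitz[OF b(2) b(2) b(4), of x z] by (simp add: abs_if split: if_splits)
    show "\<bar>(f (x + z))\<^sup>2 + e - ((f x)\<^sup>2 + e) - ((2 * f x) *\<^sub>R V x) \<bullet> z\<bar> \<le> (L\<^sup>2 + 2 * A * M) * (norm z)\<^sup>2" for z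
    proof -
      let ?d = "f (x + z) - f x"
      have "(f (x + z))\<^sup>2 + e - ((f x)\<^sup>2 + e) - ((2 * f x) *\<^sub>R V x) \<bullet> z = ?d\<^sup>2 + 2 * f x * (?d - V x \<bullet> z)"
        by (simp add: power2_eq_square algebra_simps)
      moreover have "\<bar>?d\<^sup>2\<bar> \<le> L\<^sup>2 * (norm z)\<^sup>2"
        using power_mono[OF b(3)[of x z], of 2] by (simp add: power_mult_distrib)
      moreover have "\<bar>2 * f x * (?d - V x \<bullet> z)\<bar> \<le> (2 * A) * (M * (norm z)\<^sup>2)"
        unfolding abs_mult using b(1)[of x] b(5)[of x z] c by (intro mult_mono) auto
      ultimately have "\<bar>(f (x + z))\<^sup>2 + e - ((f x)\<^sup>2 + e) - ((2 * f x) *\<^sub>R V x) \<bullet> z\<bar>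
          \<le> L\<^sup>2 * (norm z)\<^sup>2 + (2 * A) * (M * (norm z)\<^sup>2)"
        by linarith
      then show ?thesis by (simp add: algebra_simps)
    qed
  qed measurable
  from heat_entropy[OF t _ this, of x] c have
    "heat t (\<lambda>y. ((f y)\<^sup>2 + e) * ln ((f y)\<^sup>2 + e)) x
           - heat t (\<lambda>y. (f y)\<^sup>2 + e) x * ln (heat t (\<lambda>y. (f y)\<^sup>2 + e) x)
       \<le> t * heat t (\<lambda>y. 4 * (norm (V y))\<^sup>2) x"
    by simp
  also have "heat t (\<lambda>y. 4 * (norm (V y))\<^sup>2) x = 4 * heat t (\<lambda>y. (norm (V y))\<^sup>2) x"
    by (simp add: heat_def)
  finally show ?thesis by simp
qed

lemma abs_x_ln_x_le:
  fixes u A :: real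
  assumes "0 \<le> u" "u \<le> A"
  shows "\<bar>u * ln u\<bar> \<le> 1 + A\<^sup>2"
proof (cases "u = 0")
  case False
  then have u: "u > 0" using assms by simp
  have "u * ln u \<le> u * (u - 1)" using u by (intro mult_left_mono ln_le_minus_one) auto
  also have "\<dots> \<le> A\<^sup>2" using assms u power_mono[of u A 2] by (simp add: algebra_simps power2_eq_square)
  finally have 1: "u * ln u \<le> A\<^sup>2" .
  have "u * ln (1 / u) \<le> u * (1 / u - 1)" using u by (intro mult_left_mono ln_le_minus_one) auto
  then have "- (u * ln u) \<le> 1" using u by (simp add: ln_div algebra_simps)
  with 1 show ?thesis by (simp add: abs_le_iff add_increasing add_increasing2)
qed simp

text \<open>Superadditivity of \<open>u ln u\<close> compares the shifted with the unshifted integrand, so that removing the shift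
  requires only the limit of numbers and no convergence theorem for integrals.\<close>

lemma x_ln_x_add:
  fixes u e :: real
  assumes "0 \<le> u" "0 < e"
  shows "u * ln u + e * ln e \<le> (u + e) * ln (u + e)"
proof -
  have "u * ln u \<le> u * ln (u + e)" using assms by (cases "u = 0") (auto intro!: mult_left_mono)
  moreover have "e * ln e \<le> e * ln (u + e)" using assms by (intro mult_left_mono) auto
  ultimately show ?thesis by (simp add: algebra_simps)
qed

theorem heat_log_sobolev:
  fixes f :: "real ^ 'd::finite \<Rightarrow> real"
  assumes t: "t > 0" and f: "bounded_C11 f V"
  shows "heat t (\<lambda>y. (f y)\<^sup>2 * ln ((f y)\<^sup>2)) x - heat t (\<lambda>y. (f y)\<^sup>2) x * ln (heat t (\<lambda>y. (f y)\<^sup>2) x)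
       \<le> 4 * t * heat t (\<lambda>y. (norm (V y))\<^sup>2) x"
proof -
  from f obtain A where A: "0 \<le> A" "\<And>x. \<bar>f x\<bar> \<le> A" and [measurable]: "f \<in> borel_measurable borel"
    by (rule bounded_C11E) blast
  interpret prob_space "gaussian t :: (real ^ 'd) measure" by (rule prob_space_gaussian) fact
  have fA: "(f y)\<^sup>2 \<le> A\<^sup>2" for y using A(2)[of y] by (metis abs_ge_zero power2_abs power_mono)
  define m where "m = heat t (\<lambda>y. (f y)\<^sup>2) x"
  define G where "G = heat t (\<lambda>y. (norm (V y))\<^sup>2) x"
  have m0: "m \<ge> 0" unfolding m_def heat_def by simp
  have bd: "\<bar>(f y)\<^sup>2 * ln ((f y)\<^sup>2)\<bar> \<le> 1 + (A\<^sup>2)\<^sup>2" for y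
    by (rule abs_x_ln_x_le) (auto simp: fA)
  have I: "integrable (gaussian t) (\<lambda>z. (f (x + z))\<^sup>2)"
    by (rule integrable_gaussian_bounded[of _ "\<lambda>y. (f y)\<^sup>2" "A\<^sup>2"]) (use t fA in auto)
  have J: "integrable (gaussian t) (\<lambda>z. (f (x + z))\<^sup>2 * ln ((f (x + z))\<^sup>2))"
    by (rule integrable_gaussian_bounded[of _ "\<lambda>y. (f y)\<^sup>2 * ln ((f y)\<^sup>2)" "1 + (A\<^sup>2)\<^sup>2"]) (use t bd in auto)
  have le: "heat t (\<lambda>y. (f y)\<^sup>2 * ln ((f y)\<^sup>2)) x \<le> 4 * t * G + ((m + e) * ln (m + e) - e * ln e)" if e: "e > 0" for e
  proof -
    have he: "heat t (\<lambda>y. (f y)\<^sup>2 + e) x = m + e"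
      using I by (simp add: m_def heat_def prob_space[simplified])
    have "heat t (\<lambda>y. (f y)\<^sup>2 * ln ((f y)\<^sup>2)) x + e * ln e
        = (\<integral>z. (f (x + z))\<^sup>2 * ln ((f (x + z))\<^sup>2) + e * ln e \<partial>gaussian t)"
      using J by (simp add: heat_def prob_space[simplified])
    also have "\<dots> \<le> heat t (\<lambda>y. ((f y)\<^sup>2 + e) * ln ((f y)\<^sup>2 + e)) x"
      unfolding heat_def
    proof (rule integral_mono)
      have "\<bar>((f y)\<^sup>2 + e) * ln ((f y)\<^sup>2 + e)\<bar> \<le> 1 + (A\<^sup>2 + e)\<^sup>2" for y
        by (rule abs_x_ln_x_le) (use e fA in \<open>auto simp: add_nonneg_nonneg\<close>)
      then show "integrable (gaussian t) (\<lambda>z. ((f (x + z))\<^sup>2 + e) * ln ((f (x + z))\<^sup>2 + e))"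
        by (intro integrable_gaussian_bounded[of _ "\<lambda>y. ((f y)\<^sup>2 + e) * ln ((f y)\<^sup>2 + e)" "1 + (A\<^sup>2 + e)\<^sup>2"])
           (use t in auto)
    qed (use J x_ln_x_add e in auto)
    also have "\<dots> \<le> 4 * t * G + (m + e) * ln (m + e)"
      using heat_log_sobolev_shifted[OF t f e, of x] unfolding he G_def by linarith
    finally show ?thesis by linarith
  qed
  have lim: "(\<lambda>n. 4 * t * G + ((m + 1 / real (Suc n)) * ln (m + 1 / real (Suc n)) - 1 / real (Suc n) * ln (1 / real (Suc n))))
      \<longlonglongrightarrow> 4 * t * G + m * ln m"
  proof (cases "m = 0")
    case False
    have z: "(\<lambda>n. 1 / real (Suc n)) \<longlonglongrightarrow> 0"
      using LIMSEQ_inverse_real_of_nat by (simp add: inverse_eq_divide)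
    have "(\<lambda>n. - (ln (real (Suc n)) / real (Suc n))) \<longlonglongrightarrow> - 0"
      by (intro tendsto_minus LIMSEQ_Suc[OF lim_ln_over_n])
    then have "(\<lambda>n. 1 / real (Suc n) * ln (1 / real (Suc n))) \<longlonglongrightarrow> 0"
      by (simp add: ln_div)
    then have "(\<lambda>n. 4 * t * G + ((m + 1 / real (Suc n)) * ln (m + 1 / real (Suc n)) - 1 / real (Suc n) * ln (1 / real (Suc n))))
      \<longlonglongrightarrow> 4 * t * G + ((m + 0) * ln (m + 0) - 0)"
      using False by (intro tendsto_intros z) auto
    then show ?thesis by simp
  qed simp
  have "heat t (\<lambda>y. (f y)\<^sup>2 * ln ((f y)\<^sup>2)) x \<le> 4 * t * G + m * ln m"
    by (rule tendsto_lowerbound[OF lim]) (intro always_eventually allI le, auto)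
  then show ?thesis unfolding m_def G_def by linarith
qed

section \<open>Comparison of Gaussian averages at different points\<close>

text \<open>Duality between entropy and exponential moments (the Gibbs variational principle): among the
  densities \<open>F / m\<close>, the functional on the right is smallest relative to the left for \<open>F\<close> proportional to
  \<open>exp u\<close>, and the inequality is integrated from the tangent line of \<open>exp\<close> at that point.\<close>

lemma (in prob_space) entropy_duality:
  fixes F u :: "'a \<Rightarrow> real"
  assumes F: "F \<in> borel_measurable M" "\<And>x. 0 \<le> F x" "\<And>x. F x \<le> A"
    and u: "integrable M (\<lambda>x. exp (u x))" "integrable M (\<lambda>x. F x * u x)"
    and m: "(\<integral>x. F x \<partial>M) = m" "0 < m" and Z: "(\<integral>x. exp (u x) \<partial>M) = Z" "0 < Z"
  shows "(\<integral>x. F x * u x \<partial>M) \<le> (\<integral>x. F x * ln (F x) \<partial>M) - m * ln m + m * ln Z"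
proof -
  note [measurable] = F(1)
  have A: "\<bar>F x\<bar> \<le> A" for x using F(2,3)[of x] by linarith
  have IF: "integrable M F" by (rule integrable_const_bound[of _ A]) (auto simp: A)
  have IL: "integrable M (\<lambda>x. F x * ln (F x))"
    by (rule integrable_const_bound[of _ "1 + A\<^sup>2"]) (auto intro!: abs_x_ln_x_le F)
  have "F x * u x \<le> F x * ln (F x) + F x * (ln Z - ln m - 1) + (m / Z) * exp (u x)" for x
  proof (cases "F x = 0")
    case False
    then have pos: "0 < F x" using F(2)[of x] by simp
    \<comment> \<open>the tangent line inequality at the point where the exponential weight matches \<open>F\<close>\<close>
    have "F x * (1 + (u x - ln (F x) - ln Z + ln m)) \<le> F x * exp (u x - ln (F x) - ln Z + ln m)"
      using pos by (intro mult_left_mono exp_ge_add_one_self) auto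
    also have "\<dots> = (m / Z) * exp (u x)"
      using pos m Z by (simp add: exp_add exp_diff)
    finally show ?thesis by (simp add: algebra_simps)
  qed (use m Z in simp)
  then have "(\<integral>x. F x * u x \<partial>M) \<le> (\<integral>x. F x * ln (F x) + F x * (ln Z - ln m - 1) + (m / Z) * exp (u x) \<partial>M)"
    using u IF IL by (intro integral_mono) auto
  also have "\<dots> = (\<integral>x. F x * ln (F x) \<partial>M) + m * (ln Z - ln m - 1) + (m / Z) * Z"
    using u IF IL m Z by simp
  finally show ?thesis using Z by (simp add: algebra_simps)
qed

text \<open>The average at \<open>x + w\<close> as an average at \<open>x\<close> with a density. Comparing the averages at two points thus
  amounts to comparing this density with \<open>1\<close>.\<close>

lemma heat_translate:
  fixes F :: "real ^ 'd::finite \<Rightarrow> real"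
  assumes t: "t > 0" and [measurable]: "F \<in> borel_measurable borel" and "\<And>x. \<bar>F x\<bar> \<le> A"
  shows "integrable (gaussian t) (\<lambda>z. F (x + z) * exp ((w \<bullet> z) / t - (norm w)\<^sup>2 / (2 * t)))"
    and "heat t F (x + w) = (\<integral>z. F (x + z) * exp ((w \<bullet> z) / t - (norm w)\<^sup>2 / (2 * t)) \<partial>gaussian t)"
proof -
  have m: "(\<lambda>z. F (x + z)) \<in> borel_measurable borel" by measurable
  show "integrable (gaussian t) (\<lambda>z. F (x + z) * exp ((w \<bullet> z) / t - (norm w)\<^sup>2 / (2 * t)))"
    by (rule integral_gaussian_translate(1)[OF t m]) (rule assms)
  show "heat t F (x + w) = (\<integral>z. F (x + z) * exp ((w \<bullet> z) / t - (norm w)\<^sup>2 / (2 * t)) \<partial>gaussian t)"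
    using integral_gaussian_translate(2)[OF t m, of A w] assms by (simp add: heat_def add.assoc)
qed

text \<open>Let \<open>q = exp l\<close> be the density of the Gaussian at \<open>x + w\<close> relative to the one at \<open>x\<close>. Jensen's inequality for the
  weight \<open>F\<close> bounds the logarithm of the ratio of the two averages below by the weighted mean of \<open>l\<close>, and
  duality applied to \<open>- l\<close> bounds that mean in terms of the entropy of \<open>F\<close> and the mean of \<open>1 / q\<close>, which is
  \<open>exp ((norm w)\<^sup>2 / t)\<close>.\<close>

theorem heat_harnack:
  fixes F :: "real ^ 'd::finite \<Rightarrow> real"
  assumes t: "t > 0" and [measurable]: "F \<in> borel_measurable borel"
    and F: "\<And>x. 0 \<le> F x" "\<And>x. F x \<le> A" and m: "0 < heat t F x"
  shows "heat t F x * exp (- ((heat t (\<lambda>y. F y * ln (F y)) x - heat t F x * ln (heat t F x)) / heat t F x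
           + (norm w)\<^sup>2 / t)) \<le> heat t F (x + w)"
proof -
  interpret prob_space "gaussian t :: (real ^ 'd) measure" by (rule prob_space_gaussian) fact
  have A: "\<bar>F x\<bar> \<le> A" for x using F[of x] by linarith
  let ?l = "\<lambda>z. (w \<bullet> z) / t - (norm w)\<^sup>2 / (2 * t)"
  define g where "g = heat t F x"
  define E where "E = heat t (\<lambda>y. F y * ln (F y)) x - g * ln g"
  have g: "g > 0" "(\<integral>z. F (x + z) \<partial>gaussian t) = g" using m by (auto simp: g_def heat_def)
  have I: "integrable (gaussian t) (\<lambda>z. F (x + z))"
    by (rule integrable_gaussian_bounded[OF t, of _ A]) (auto simp: A)
  have I1: "integrable (gaussian t) (\<lambda>z. w \<bullet> z)"
  proof (rule Bochner_Integration.integrable_bound[OF integrable_mult_right[OF integrable_gaussian_norm[OF t], of "norm w"]])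
    show "AE z in gaussian t. norm (w \<bullet> z) \<le> norm (norm w * norm z)"
      by (rule AE_I2) (simp add: Cauchy_Schwarz_ineq2)
  qed measurable
  have Il: "integrable (gaussian t) (\<lambda>z. F (x + z) * ?l z)"
  proof (rule Bochner_Integration.integrable_bound[of _ "\<lambda>z. A * \<bar>?l z\<bar>"])
    show "integrable (gaussian t) (\<lambda>z. A * \<bar>?l z\<bar>)" using I1 by simp
    show "AE z in gaussian t. norm (F (x + z) * ?l z) \<le> norm (A * \<bar>?l z\<bar>)"
    proof (rule AE_I2)
      fix z
      have "\<bar>F (x + z)\<bar> * \<bar>?l z\<bar> \<le> A * \<bar>?l z\<bar>" by (intro mult_right_mono A) auto
      then show "norm (F (x + z) * ?l z) \<le> norm (A * \<bar>?l z\<bar>)"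
        by (simp only: real_norm_def abs_mult abs_abs) (meson abs_ge_self mult_right_mono abs_ge_zero order_trans)
    qed
  qed measurable
  have e: "exp (- ?l z) = exp ((norm w)\<^sup>2 / (2 * t)) * exp (((- 1 / t) *\<^sub>R w) \<bullet> z)" for z
    by (simp add: exp_add[symmetric])
  have Ie: "integrable (gaussian t) (\<lambda>z. exp (- ?l z))"
    unfolding e by (intro integrable_mult_right integrable_gaussian_exp t)
  have Z: "(\<integral>z. exp (- ?l z) \<partial>gaussian t) = exp ((norm w)\<^sup>2 / t)"
  proof -
    have "(\<integral>z. exp (- ?l z) \<partial>gaussian t) = exp ((norm w)\<^sup>2 / (2 * t)) * exp (t * (norm ((- 1 / t) *\<^sub>R w))\<^sup>2 / 2)"
      unfolding e by (simp only: integral_mult_right_zero integral_gaussian_exp[OF t])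
    also have "\<dots> = exp ((norm w)\<^sup>2 / t)"
      unfolding exp_add[symmetric] using t by (simp add: power_mult_distrib power_divide power2_eq_square)
    finally show ?thesis .
  qed
  define s where "s = (\<integral>z. F (x + z) * ?l z \<partial>gaussian t) / g"
  \<comment> \<open>Jensen's inequality, from the tangent line of \<open>exp\<close> at \<open>s\<close>\<close>
  have "(\<integral>z. exp s * (F (x + z) * (1 - s) + F (x + z) * ?l z) \<partial>gaussian t) \<le> (\<integral>z. F (x + z) * exp (?l z) \<partial>gaussian t)"
  proof (rule integral_mono)
    show "integrable (gaussian t) (\<lambda>z. exp s * (F (x + z) * (1 - s) + F (x + z) * ?l z))"
      by (intro integrable_mult_right Bochner_Integration.integrable_add integrable_mult_left I Il)
    show "integrable (gaussian t) (\<lambda>z. F (x + z) * exp (?l z))"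
      by (rule heat_translate(1)[OF t _ A]) measurable
    fix z
    have "(F (x + z) * exp s) * (1 + (u - s)) \<le> F (x + z) * exp u" for u
    proof -
      have "(F (x + z) * exp s) * (1 + (u - s)) \<le> (F (x + z) * exp s) * exp (u - s)"
        using F by (intro mult_left_mono exp_ge_add_one_self) auto
      then show ?thesis by (simp add: exp_diff)
    qed
    from this[of "?l z"] show "exp s * (F (x + z) * (1 - s) + F (x + z) * ?l z) \<le> F (x + z) * exp (?l z)"
      by (simp only: distrib_left right_diff_distrib mult_ac mult_1_right mult_1_left) (simp only: algebra_simps)
  qed
  also have "\<dots> = heat t F (x + w)"
    by (rule heat_translate(2)[OF t _ A, symmetric]) measurable
  also have "(\<integral>z. exp s * (F (x + z) * (1 - s) + F (x + z) * ?l z) \<partial>gaussian t) = exp s * (g * (1 - s) + g * s)"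
    using g by (simp only: integral_mult_right_zero Bochner_Integration.integral_add[OF integrable_mult_left[OF I] Il]
        integral_mult_left_zero) (simp add: s_def)
  finally have "g * exp s \<le> heat t F (x + w)"
    by (simp add: algebra_simps)
  moreover have "- (E / g + (norm w)\<^sup>2 / t) \<le> s"
  proof -
    have Il': "integrable (gaussian t) (\<lambda>z. F (x + z) * - ?l z)"
      using integrable_minus[OF Il] by (simp only: mult_minus_right)
    have "(\<integral>z. F (x + z) * - ?l z \<partial>gaussian t) \<le> (\<integral>z. F (x + z) * ln (F (x + z)) \<partial>gaussian t) - g * ln g + g * ln (exp ((norm w)\<^sup>2 / t))"
      by (rule entropy_duality[of "\<lambda>z. F (x + z)" A]) (use F g Ie Il' Z in auto)
    also have "(\<integral>z. F (x + z) * - ?l z \<partial>gaussian t) = - (g * s)"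
      using g by (simp only: mult_minus_right integral_minus) (simp add: s_def)
    finally have "- (g * s) \<le> E + g * ((norm w)\<^sup>2 / t)"
      by (simp add: E_def heat_def)
    then show ?thesis using g by (simp add: field_simps)
  qed
  ultimately show ?thesis
    using g unfolding E_def g_def[symmetric] by (meson exp_le_cancel_iff less_imp_le mult_left_mono order_trans)
qed

text \<open>The difference of the two averages is the covariance of \<open>f\<close> with the density \<open>q\<close>, and the variance of \<open>q\<close> is
  \<open>exp ((norm w)\<^sup>2 / t) - 1\<close>.\<close>

theorem heat_difference_square:
  fixes f :: "real ^ 'd::finite \<Rightarrow> real"
  assumes t: "t > 0" and fm [measurable]: "f \<in> borel_measurable borel" and A: "\<And>x. \<bar>f x\<bar> \<le> A"
  shows "(heat t f (x + w) - heat t f x)\<^sup>2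
       \<le> (exp ((norm w)\<^sup>2 / t) - 1) * (heat t (\<lambda>y. (f y)\<^sup>2) x - (heat t f x)\<^sup>2)"
proof -
  interpret prob_space "gaussian t :: (real ^ 'd) measure" by (rule prob_space_gaussian) fact
  let ?q = "\<lambda>z. exp ((w \<bullet> z) / t - (norm w)\<^sup>2 / (2 * t))"
  define e where "e = heat t f x"
  define v where "v = heat t (\<lambda>y. (f y)\<^sup>2) x - e\<^sup>2"
  define B where "B = exp ((norm w)\<^sup>2 / t) - 1"
  define C where "C = heat t f (x + w) - e"
  have A2: "\<bar>(f y)\<^sup>2\<bar> \<le> A\<^sup>2" for y using A[of y] by (metis abs_ge_zero power2_abs power_mono abs_power2)
  have If: "integrable (gaussian t) (\<lambda>z. f (x + z))"
    by (rule integrable_gaussian_bounded[OF t, of _ A]) (auto simp: A)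
  have If2: "integrable (gaussian t) (\<lambda>z. (f (x + z))\<^sup>2)"
    by (rule integrable_gaussian_bounded[OF t, of "\<lambda>y. (f y)\<^sup>2" "A\<^sup>2"]) (use A2 in auto)
  have Iq: "integrable (gaussian t) ?q" and q1: "(\<integral>z. ?q z \<partial>gaussian t) = 1"
    using heat_translate[OF t, where F = "\<lambda>_. 1" and A = 1 and x = x and w = w] t by simp_all
  have Ifq: "integrable (gaussian t) (\<lambda>z. f (x + z) * ?q z)"
    and fq: "(\<integral>z. f (x + z) * ?q z \<partial>gaussian t) = heat t f (x + w)"
    using heat_translate[OF t fm A, where x = x and w = w] by simp_all
  have q2: "(?q z)\<^sup>2 = exp (- ((norm w)\<^sup>2 / t)) * exp (((2 / t) *\<^sub>R w) \<bullet> z)" for z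
    by (simp add: exp_add[symmetric] exp_double[symmetric] field_simps power2_eq_square)
  have Iq2: "integrable (gaussian t) (\<lambda>z. (?q z)\<^sup>2)"
    unfolding q2 by (intro integrable_mult_right integrable_gaussian_exp t)
  have q2': "(\<integral>z. (?q z)\<^sup>2 \<partial>gaussian t) = exp ((norm w)\<^sup>2 / t)"
  proof -
    have "(\<integral>z. (?q z)\<^sup>2 \<partial>gaussian t) = exp (- ((norm w)\<^sup>2 / t)) * exp (t * (norm ((2 / t) *\<^sub>R w))\<^sup>2 / 2)"
      unfolding q2 by (simp only: integral_mult_right_zero integral_gaussian_exp[OF t])
    also have "\<dots> = exp ((norm w)\<^sup>2 / t)"
      unfolding exp_add[symmetric] using t by (simp add: power_mult_distrib power_divide power2_eq_square)
    finally show ?thesis .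
  qed
  \<comment> \<open>\<open>C\<close> is the covariance of \<open>f\<close> and the density \<open>q\<close>; the Cauchy-Schwarz inequality is the
    nonnegativity of the mean of this square\<close>
  have "0 \<le> (\<integral>z. (B * (f (x + z) - e) - C * (?q z - 1))\<^sup>2 \<partial>gaussian t)"
    by simp
  also have "\<dots> = (\<integral>z. (B\<^sup>2 * (f (x + z))\<^sup>2 + (2 * B * (C - B * e)) * f (x + z) + (C - B * e)\<^sup>2)
      + (C\<^sup>2 * (?q z)\<^sup>2 + (2 * C * (B * e - C)) * ?q z - (2 * B * C) * (f (x + z) * ?q z)) \<partial>gaussian t)"
    by (intro Bochner_Integration.integral_cong) (auto simp: power2_eq_square algebra_simps)
  also have "\<dots> = (B\<^sup>2 * (v + e\<^sup>2) + (2 * B * (C - B * e)) * e + (C - B * e)\<^sup>2)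
      + (C\<^sup>2 * (B + 1) + (2 * C * (B * e - C)) - (2 * B * C) * (C + e))"
  proof -
    have "(\<integral>z. (f (x + z))\<^sup>2 \<partial>gaussian t) = v + e\<^sup>2" "(\<integral>z. f (x + z) \<partial>gaussian t) = e"
      "(\<integral>z. f (x + z) * ?q z \<partial>gaussian t) = C + e" "(\<integral>z. (?q z)\<^sup>2 \<partial>gaussian t) = B + 1"
      using fq q2' by (simp_all add: v_def e_def heat_def C_def B_def)
    then show ?thesis
      using If If2 Iq Ifq Iq2 q1 by (simp add: prob_space[simplified])
  qed
  also have "\<dots> = B * (B * v - C\<^sup>2)"
    by (simp add: power2_eq_square algebra_simps)
  finally have le: "0 \<le> B * (B * v - C\<^sup>2)" .
  have "C\<^sup>2 \<le> B * v"
  proof (cases "w = 0")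
    case False
    then have "B > 0" using t by (simp add: B_def)
    with le show ?thesis by (simp add: zero_le_mult_iff)
  qed (simp add: C_def e_def B_def)
  then show ?thesis by (simp add: C_def B_def v_def e_def)
qed

section \<open>Entropy of a square under centering\<close>

lemma x_ln_x_le_half_square:
  fixes x :: real
  assumes "1 \<le> x"
  shows "x * ln x \<le> (x\<^sup>2 - 1) / 2"
proof -
  let ?f = "\<lambda>x::real. (x\<^sup>2 - 1) / 2 - x * ln x"
  have "?f 1 \<le> ?f x"
  proof (rule DERIV_nonneg_imp_nondecreasing[OF assms])
    fix y :: real assume y: "1 \<le> y" "y \<le> x"
    have "(?f has_real_derivative y - (ln y + 1)) (at y)"
      using y by (auto intro!: derivative_eq_intros)
    moreover have "0 \<le> y - (ln y + 1)" using ln_le_minus_one[of y] y by simp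
    ultimately show "\<exists>d. (?f has_real_derivative d) (at y) \<and> 0 \<le> d" by blast
  qed
  then show ?thesis by simp
qed

lemma ln_one_plus_square_le:
  fixes h :: real
  assumes "0 \<le> h"
  shows "ln (1 + h\<^sup>2) \<le> h"
proof -
  let ?f = "\<lambda>x::real. x - ln (1 + x\<^sup>2)"
  have "?f 0 \<le> ?f h"
  proof (rule DERIV_nonneg_imp_nondecreasing[OF assms])
    fix y :: real
    have pos: "1 + y\<^sup>2 > 0" by (simp add: add_pos_nonneg)
    have "(?f has_real_derivative 1 - 2 * y / (1 + y\<^sup>2)) (at y)"
      using pos by (auto intro!: derivative_eq_intros)
    moreover have "0 \<le> 1 - 2 * y / (1 + y\<^sup>2)"
      using pos zero_le_power2[of "1 - y"] by (simp add: divide_le_eq power2_diff)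
    ultimately show "\<exists>d. (?f has_real_derivative d) (at y) \<and> 0 \<le> d" by blast
  qed
  then show ?thesis by simp
qed

text \<open>The key pointwise estimate, for mean \<open>1\<close>. Writing \<open>b = 1 + h\<^sup>2\<close>, one has \<open>(1 + h)\<^sup>2 = b + 2 h\<close>, and the
  logarithm is expanded around \<open>b\<close>. The linear term \<open>2 h\<close> will have mean zero. For \<open>h \<ge> 0\<close> the
  tangent line of the logarithm is too weak to reach the coefficient \<open>4\<close>, so the second order bound above is used.\<close>

lemma square_ln_square_shift_one:
  fixes h :: real
  shows "(1 + h)\<^sup>2 * ln ((1 + h)\<^sup>2) \<le> (1 + h\<^sup>2) * ln (1 + h\<^sup>2) + 4 * h\<^sup>2 + 2 * h"
proof -
  define b where "b = 1 + h\<^sup>2"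
  have b: "b \<ge> 1" "b > 0" by (auto simp: b_def add_pos_nonneg)
  have a: "(1 + h)\<^sup>2 = b + 2 * h" by (simp add: b_def power2_eq_square algebra_simps)
  have h2: "h\<^sup>2 \<le> b" by (simp add: b_def)
  show ?thesis
  proof (cases "h \<ge> 0")
    case True
    let ?x = "(b + 2 * h) / b"
    have x: "?x \<ge> 1" using True b by simp
    have "(b + 2 * h) * ln (b + 2 * h) = (b + 2 * h) * ln b + b * (?x * ln ?x)"
    proof -
      have "ln ?x = ln (b + 2 * h) - ln b" using True b by (intro ln_divide_pos) auto
      moreover have "b * (?x * y) = (b + 2 * h) * y" for y using b by simp
      ultimately show ?thesis by (simp only: right_diff_distrib)
    qed
    also have "\<dots> \<le> (b + 2 * h) * ln b + b * ((?x\<^sup>2 - 1) / 2)"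
      using b x_ln_x_le_half_square[OF x] by (intro add_left_mono mult_left_mono) auto
    also have "b * ((?x\<^sup>2 - 1) / 2) = 2 * h + 2 * h\<^sup>2 / b"
      using b by (simp add: field_simps power2_eq_square)
    also have "2 * h\<^sup>2 / b \<le> 2 * h\<^sup>2" using b by (simp add: divide_le_eq mult_le_cancel_left1)
    also have "(b + 2 * h) * ln b = b * ln b + 2 * (h * ln b)" by (simp add: algebra_simps)
    also have "h * ln b \<le> h * h"
    proof (rule mult_left_mono[OF _ True])
      show "ln b \<le> h" using ln_one_plus_square_le[OF True] by (simp add: b_def)
    qed
    finally show ?thesis unfolding a by (simp add: b_def power2_eq_square)
  next
    case False
    show ?thesis
    proof (cases "b + 2 * h = 0")
      case True
      have "0 \<le> b * ln b" using b by simp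
      moreover have "h = - 1" using True a by simp
      then have "0 \<le> 4 * h\<^sup>2 + 2 * h" by simp
      ultimately have "0 \<le> b * ln b + 4 * h\<^sup>2 + 2 * h" by linarith
      then show ?thesis unfolding a True by (simp add: b_def)
    next
      case nz: False
      then have pos: "b + 2 * h > 0" using a zero_le_power2[of "1 + h"] by linarith
      have "(b + 2 * h) * (ln (b + 2 * h) - ln b) \<le> (b + 2 * h) * ((b + 2 * h - b) / b)"
        using pos b by (intro mult_left_mono ln_diff_le) auto
      also have "\<dots> = 2 * h + 4 * h\<^sup>2 / b"
        using b by (simp add: field_simps power2_eq_square)
      also have "4 * h\<^sup>2 / b \<le> 4 * h\<^sup>2" using b by (simp add: divide_le_eq mult_le_cancel_left1)
      finally have "(b + 2 * h) * ln (b + 2 * h) \<le> b * ln b + 2 * h * ln b + 2 * h + 4 * h\<^sup>2"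
        by (simp add: algebra_simps)
      moreover have "2 * h * ln b \<le> 0" using False b by (simp add: mult_nonpos_nonneg)
      ultimately show ?thesis unfolding a by (simp add: b_def)
    qed
  qed
qed

text \<open>The estimate in homogeneous form, with a free parameter \<open>s\<close> that will be the mean of \<open>h\<^sup>2\<close>. It is arranged so
  that, for \<open>h\<close> of mean zero, the right-hand side integrates to the entropy of \<open>h\<^sup>2\<close> plus explicit terms in \<open>m\<close> and \<open>s\<close>.\<close>

lemma square_ln_square_shift:
  fixes m h s :: real
  assumes m: "m \<noteq> 0" and s: "0 < s"
  shows "(m + h)\<^sup>2 * ln ((m + h)\<^sup>2)
       \<le> h\<^sup>2 * ln (h\<^sup>2) + (m\<^sup>2 + h\<^sup>2) * ln (m\<^sup>2 + s) - h\<^sup>2 * ln s + 4 * h\<^sup>2 + 2 * m * (1 + ln (m\<^sup>2)) * h"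
proof -
  have m2: "m\<^sup>2 > 0" using m by simp
  let ?k = "h / m"
  have hm: "m + h = m * (1 + ?k)" using m by (simp add: field_simps)
  have "(m + h)\<^sup>2 * ln ((m + h)\<^sup>2) = m\<^sup>2 * ((1 + ?k)\<^sup>2 * ln ((1 + ?k)\<^sup>2)) + (m + h)\<^sup>2 * ln (m\<^sup>2)"
  proof (cases "1 + ?k = 0")
    case False
    then show ?thesis unfolding hm power_mult_distrib using m
      by (subst ln_mult) (auto simp: algebra_simps)
  qed (simp add: hm)
  also have "\<dots> \<le> m\<^sup>2 * ((1 + ?k\<^sup>2) * ln (1 + ?k\<^sup>2) + 4 * ?k\<^sup>2 + 2 * ?k) + (m + h)\<^sup>2 * ln (m\<^sup>2)"
    using m2 square_ln_square_shift_one[of ?k] by (intro add_right_mono mult_left_mono) auto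
  also have "1 + ?k\<^sup>2 = (m\<^sup>2 + h\<^sup>2) / m\<^sup>2" using m by (simp add: field_simps power_divide)
  also have "m\<^sup>2 * ((m\<^sup>2 + h\<^sup>2) / m\<^sup>2 * ln ((m\<^sup>2 + h\<^sup>2) / m\<^sup>2) + 4 * ?k\<^sup>2 + 2 * ?k) + (m + h)\<^sup>2 * ln (m\<^sup>2)
      = (m\<^sup>2 + h\<^sup>2) * ln (m\<^sup>2 + h\<^sup>2) + 4 * h\<^sup>2 + 2 * m * (1 + ln (m\<^sup>2)) * h"
  proof -
    have "ln ((m\<^sup>2 + h\<^sup>2) / m\<^sup>2) = ln (m\<^sup>2 + h\<^sup>2) - ln (m\<^sup>2)"
      using m2 by (intro ln_divide_pos) (auto simp: add_pos_nonneg)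
    then have "m\<^sup>2 * ((m\<^sup>2 + h\<^sup>2) / m\<^sup>2 * ln ((m\<^sup>2 + h\<^sup>2) / m\<^sup>2)) = (m\<^sup>2 + h\<^sup>2) * (ln (m\<^sup>2 + h\<^sup>2) - ln (m\<^sup>2))"
      using m by simp
    moreover have "m\<^sup>2 * ?k\<^sup>2 = h\<^sup>2" "m\<^sup>2 * ?k = m * h" using m by (simp_all add: power_divide power2_eq_square)
    moreover have "m\<^sup>2 * (X + 4 * ?k\<^sup>2 + 2 * ?k) = m\<^sup>2 * X + 4 * (m\<^sup>2 * ?k\<^sup>2) + 2 * (m\<^sup>2 * ?k)" for X
      by (simp only: distrib_left mult_ac)
    moreover have "(m + h)\<^sup>2 * l = (m\<^sup>2 + h\<^sup>2) * l + 2 * m * h * l" for l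
      by (simp add: power2_sum algebra_simps)
    ultimately show ?thesis by (simp only:) (simp add: algebra_simps)
  qed
  also have "(m\<^sup>2 + h\<^sup>2) * ln (m\<^sup>2 + h\<^sup>2) \<le> h\<^sup>2 * ln (h\<^sup>2) + (m\<^sup>2 + h\<^sup>2) * ln (m\<^sup>2 + s) - h\<^sup>2 * ln s"
  proof -
    \<comment> \<open>the log-sum inequality for the pairs \<open>(m\<^sup>2, m\<^sup>2)\<close> and \<open>(h\<^sup>2, s)\<close>\<close>
    define a where "a = (m\<^sup>2 + h\<^sup>2) / (m\<^sup>2 + s)"
    have pos: "m\<^sup>2 + h\<^sup>2 > 0" "m\<^sup>2 + s > 0" "a > 0" using m2 s by (auto simp: a_def add_pos_nonneg add_pos_pos)
    have la: "ln a = ln (m\<^sup>2 + h\<^sup>2) - ln (m\<^sup>2 + s)" using pos unfolding a_def by (intro ln_divide_pos) auto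
    have "m\<^sup>2 * ln a \<le> m\<^sup>2 * (a - 1)" using m2 pos by (intro mult_left_mono ln_le_minus_one) auto
    moreover have "h\<^sup>2 * ln a \<le> h\<^sup>2 * (ln (h\<^sup>2) - ln s) + (s * a - h\<^sup>2)"
    proof (cases "h = 0")
      case False
      have "ln (a * s) - ln (h\<^sup>2) \<le> (a * s - h\<^sup>2) / h\<^sup>2"
        using False pos s by (intro ln_diff_le) auto
      then have "h\<^sup>2 * (ln (a * s) - ln (h\<^sup>2)) \<le> h\<^sup>2 * ((a * s - h\<^sup>2) / h\<^sup>2)"
        by (intro mult_left_mono) auto
      also have "h\<^sup>2 * ((a * s - h\<^sup>2) / h\<^sup>2) = a * s - h\<^sup>2" using False by simp
      finally show ?thesis using pos s by (simp add: ln_mult algebra_simps)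
    qed (use pos s in simp)
    moreover have "m\<^sup>2 * (a - 1) + (s * a - h\<^sup>2) = 0"
      using pos by (simp add: a_def field_simps)
    ultimately have "(m\<^sup>2 + h\<^sup>2) * ln a \<le> h\<^sup>2 * (ln (h\<^sup>2) - ln s)"
      by (simp add: distrib_right)
    then show ?thesis unfolding la by (simp add: algebra_simps)
  qed
  finally show ?thesis by linarith
qed

text \<open>A form of Rothaus' lemma. The optimal coefficient is \<open>2\<close>; the value \<open>4\<close> has a short pointwise proof and
  is just small enough for the final constant.\<close>

theorem (in prob_space) ent_square_shift:
  fixes f :: "'a \<Rightarrow> real"
  assumes [measurable]: "f \<in> borel_measurable M" and A: "\<And>x. \<bar>f x\<bar> \<le> A"
  defines "m \<equiv> \<integral>x. f x \<partial>M"
  shows "ent M (\<lambda>x. (f x)\<^sup>2) \<le> ent M (\<lambda>x. (f x - m)\<^sup>2) + 4 * (\<integral>x. (f x - m)\<^sup>2 \<partial>M)"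
proof -
  define h where "h x = f x - m" for x
  define s where "s = (\<integral>x. (h x)\<^sup>2 \<partial>M)"
  have [measurable]: "h \<in> borel_measurable M" unfolding h_def[abs_def] by measurable
  define B where "B = A + \<bar>m\<bar>"
  have hB: "\<bar>h x\<bar> \<le> B" for x using A[of x] by (simp add: h_def B_def)
  have fB: "\<bar>f x\<bar> \<le> B" for x using A[of x] by (simp add: B_def)
  have sq: "u\<^sup>2 \<le> B\<^sup>2" if "\<bar>u\<bar> \<le> B" for u using that by (metis abs_ge_zero power2_abs power_mono)
  have If: "integrable M f" by (rule integrable_const_bound[of _ B]) (auto simp: fB)
  have Ih: "integrable M h" by (rule integrable_const_bound[of _ B]) (auto simp: hB)
  have Ih2: "integrable M (\<lambda>x. (h x)\<^sup>2)"
    by (rule integrable_const_bound[of _ "B\<^sup>2"]) (auto simp: sq hB)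
  have Ihl: "integrable M (\<lambda>x. (h x)\<^sup>2 * ln ((h x)\<^sup>2))"
    by (rule integrable_const_bound[of _ "1 + (B\<^sup>2)\<^sup>2"]) (simp_all only: real_norm_def abs_x_ln_x_le sq hB zero_le_power2 AE_I2, measurable)
  have Ifl: "integrable M (\<lambda>x. (f x)\<^sup>2 * ln ((f x)\<^sup>2))"
    by (rule integrable_const_bound[of _ "1 + (B\<^sup>2)\<^sup>2"]) (simp_all only: real_norm_def abs_x_ln_x_le sq fB zero_le_power2 AE_I2, measurable)
  have h0: "(\<integral>x. h x \<partial>M) = 0" using If by (simp add: h_def m_def prob_space)
  have s0: "s \<ge> 0" by (simp add: s_def)
  have f2: "(\<integral>x. (f x)\<^sup>2 \<partial>M) = m\<^sup>2 + s"
  proof -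
    have "(\<integral>x. (f x)\<^sup>2 \<partial>M) = (\<integral>x. m\<^sup>2 + (h x)\<^sup>2 + 2 * m * h x \<partial>M)"
      by (intro Bochner_Integration.integral_cong) (auto simp: h_def power2_eq_square algebra_simps)
    also have "\<dots> = m\<^sup>2 + s" using Ih Ih2 h0 by (simp add: s_def prob_space)
    finally show ?thesis .
  qed
  consider "m = 0" | "m \<noteq> 0" "s = 0" | "m \<noteq> 0" "s > 0" using s0 by linarith
  then have "ent M (\<lambda>x. (f x)\<^sup>2) \<le> ent M (\<lambda>x. (h x)\<^sup>2) + 4 * s"
  proof cases
    case 1
    then show ?thesis using s0 by (simp add: h_def)
  next
    case 2
    have "AE x in M. (h x)\<^sup>2 = 0"
      using Ih2 2 by (subst integral_nonneg_eq_0_iff_AE[symmetric]) (auto simp: s_def)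
    then have ae: "AE x in M. h x = 0" by eventually_elim simp
    have "(\<integral>x. (f x)\<^sup>2 * ln ((f x)\<^sup>2) \<partial>M) = (\<integral>x. m\<^sup>2 * ln (m\<^sup>2) \<partial>M)"
      using ae by (intro integral_cong_AE) (auto simp: h_def elim!: eventually_mono)
    moreover have "(\<integral>x. (h x)\<^sup>2 * ln ((h x)\<^sup>2) \<partial>M) = (\<integral>x. 0 \<partial>M)"
      using ae by (intro integral_cong_AE) (auto elim!: eventually_mono)
    ultimately show ?thesis
      using 2 f2 by (simp add: ent_def prob_space s_def)
  next
    case 3
    have "(\<integral>x. (f x)\<^sup>2 * ln ((f x)\<^sup>2) \<partial>M)
        \<le> (\<integral>x. ((h x)\<^sup>2 * ln ((h x)\<^sup>2) + (m\<^sup>2 * ln (m\<^sup>2 + s) + (ln (m\<^sup>2 + s) - ln s + 4) * (h x)\<^sup>2))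
             + (2 * m * (1 + ln (m\<^sup>2))) * h x \<partial>M)"
    proof (intro integral_mono Ifl Bochner_Integration.integrable_add integrable_mult_right Ih Ih2 Ihl integrable_const)
      fix x
      show "(f x)\<^sup>2 * ln ((f x)\<^sup>2) \<le> ((h x)\<^sup>2 * ln ((h x)\<^sup>2) + (m\<^sup>2 * ln (m\<^sup>2 + s) + (ln (m\<^sup>2 + s) - ln s + 4) * (h x)\<^sup>2))
             + (2 * m * (1 + ln (m\<^sup>2))) * h x"
        using square_ln_square_shift[OF 3, of "h x"] by (simp add: h_def algebra_simps)
    qed
    also have "\<dots> = (\<integral>x. (h x)\<^sup>2 * ln ((h x)\<^sup>2) \<partial>M) + (m\<^sup>2 * ln (m\<^sup>2 + s) + (ln (m\<^sup>2 + s) - ln s + 4) * s)"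
      using Ih Ih2 Ihl h0 by (simp add: s_def prob_space)
    finally show ?thesis
      unfolding ent_def f2 s_def[symmetric] by (simp add: algebra_simps)
  qed
  then show ?thesis by (simp add: h_def s_def)
qed

section \<open>Regularity of test functions\<close>

lemma has_derivative_gradient:
  fixes f :: "real ^ 'd::finite \<Rightarrow> real"
  assumes "f differentiable (at x)"
  shows "(f has_derivative (\<lambda>z. gradient f x \<bullet> z)) (at x)"
proof -
  let ?D = "frechet_derivative f (at x)"
  have D: "(f has_derivative ?D) (at x)" using assms by (simp add: frechet_derivative_works)
  then interpret linear ?D by (rule has_derivative_linear)
  have "?D z = gradient f x \<bullet> z" for z
  proof -
    have "(\<Sum>i\<in>UNIV. z $ i *\<^sub>R axis i 1) = z"
      using basis_expansion[of z] unfolding scalar_mult_eq_scaleR .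
    then have "?D z = ?D (\<Sum>i\<in>UNIV. z $ i *\<^sub>R axis i 1)" by simp
    also have "\<dots> = (\<Sum>i\<in>UNIV. z $ i * partial_deriv i f x)"
      by (simp add: sum scale partial_deriv_def)
    also have "\<dots> = gradient f x \<bullet> z"
      by (simp add: inner_vec_def gradient_def mult.commute)
    finally show ?thesis .
  qed
  then have "?D = (\<lambda>z. gradient f x \<bullet> z)" by blast
  with D show ?thesis by simp
qed

lemma bounded_range_bound:
  fixes f :: "'a \<Rightarrow> real"
  assumes "bounded (range f)"
  obtains B where "0 \<le> B" "\<And>x. \<bar>f x\<bar> \<le> B"
proof -
  from assms obtain b where "b > 0" "\<forall>y\<in>range f. norm y \<le> b" unfolding bounded_pos by blast
  then show thesis using that[of b] by simp
qed

lemma gradient_bound: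
  fixes f :: "real ^ 'd::finite \<Rightarrow> real"
  assumes "\<And>i. bounded (range (partial_deriv i f))"
  obtains L where "0 \<le> L" "\<And>x. norm (gradient f x) \<le> L"
proof -
  have "\<forall>i. \<exists>B. 0 \<le> B \<and> (\<forall>x. \<bar>partial_deriv i f x\<bar> \<le> B)"
    using bounded_range_bound[OF assms] by metis
  then obtain B where B: "\<And>i. 0 \<le> B i" "\<And>i x. \<bar>partial_deriv i f x\<bar> \<le> B i" by metis
  show thesis
  proof
    show "0 \<le> (\<Sum>i\<in>UNIV. B i)" by (intro sum_nonneg B)
    show "norm (gradient f x) \<le> (\<Sum>i\<in>UNIV. B i)" for x
      by (rule order_trans[OF norm_le_l1_cart]) (auto simp: gradient_def intro!: sum_mono B)
  qed
qed

lemma lipschitz_of_gradient_bound: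
  fixes f :: "real ^ 'd::finite \<Rightarrow> real"
  assumes "\<And>x. f differentiable (at x)" and "\<And>x. norm (gradient f x) \<le> L"
  shows "\<bar>f (x + z) - f x\<bar> \<le> L * norm z"
proof -
  have "norm (f (x + z) - f x) \<le> L * norm ((x + z) - x)"
  proof (rule differentiable_bound)
    show "(f has_derivative (\<lambda>z. gradient f y \<bullet> z)) (at y within UNIV)" for y
      by (rule has_derivative_gradient) (rule assms)
    show "onorm (\<lambda>z. gradient f y \<bullet> z) \<le> L" for y
      by (rule onorm_le) (auto intro!: order_trans[OF Cauchy_Schwarz_ineq2] mult_right_mono assms)
  qed auto
  then show ?thesis by simp
qed

text \<open>Bounded derivatives up to order two suffice: the mean value theorem for \<open>f\<close> and for its partial derivatives
  gives the Lipschitz bounds, and linearization on a ball around \<open>x\<close> the Taylor estimate.\<close>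

lemma bounded_C11_Cb_infty:
  fixes f :: "real ^ 'd::finite \<Rightarrow> real"
  assumes "f \<in> Cb_infty"
  shows "bounded_C11 f (gradient f)"
proof -
  have "Cb (Suc (Suc 0)) f" using assms by (simp only: Cb_infty_def mem_Collect_eq)
  then have b: "bounded (range f)" and d: "\<And>x. f differentiable (at x)"
    and b1: "\<And>i. bounded (range (partial_deriv i f))"
    and d1: "\<And>i x. partial_deriv i f differentiable (at x)"
    and b2: "\<And>i j. bounded (range (partial_deriv j (partial_deriv i f)))"
    by auto
  obtain A where A: "\<And>x. \<bar>f x\<bar> \<le> A" using bounded_range_bound[OF b] by metis
  obtain L where L: "0 \<le> L" "\<And>x. norm (gradient f x) \<le> L" using gradient_bound[OF b1] by metis
  have "\<forall>i. \<exists>M. 0 \<le> M \<and> (\<forall>x. norm (gradient (partial_deriv i f) x) \<le> M)"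
    using gradient_bound[OF b2] by metis
  then obtain M where M: "\<And>i. 0 \<le> M i" "\<And>i x. norm (gradient (partial_deriv i f) x) \<le> M i" by metis
  define N where "N = (\<Sum>i\<in>UNIV. M i)"
  have N0: "0 \<le> N" unfolding N_def by (intro sum_nonneg M)
  have V: "norm (gradient f (x + z) - gradient f x) \<le> N * norm z" for x z
  proof -
    have "norm (gradient f (x + z) - gradient f x) \<le> (\<Sum>i\<in>UNIV. \<bar>(gradient f (x + z) - gradient f x) $ i\<bar>)"
      by (rule norm_le_l1_cart)
    also have "\<dots> \<le> (\<Sum>i\<in>UNIV. M i * norm z)"
      using lipschitz_of_gradient_bound[OF d1 M(2)] by (intro sum_mono) (simp add: gradient_def)
    finally show ?thesis by (simp add: N_def sum_distrib_right)
  qed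
  have T: "\<bar>f (x + z) - f x - gradient f x \<bullet> z\<bar> \<le> N * (norm z)\<^sup>2" for x z
  proof -
    have "norm (f (x + z) - f x - (\<lambda>y. gradient f x \<bullet> y) ((x + z) - x)) \<le> norm ((x + z) - x) * (N * norm z)"
    proof (rule differentiable_bound_linearization[where S = "cball x (norm z)" and f' = "\<lambda>y h. gradient f y \<bullet> h"])
      show "x + s *\<^sub>R (x + z - x) \<in> cball x (norm z)" if "s \<in> {0..1}" for s :: real
        using that by (auto simp: dist_norm intro!: mult_left_le_one_le)
      show "(f has_derivative (\<lambda>h. gradient f y \<bullet> h)) (at y within cball x (norm z))" for y
        by (rule has_derivative_at_withinI[OF has_derivative_gradient]) (rule d)
      show "onorm ((\<lambda>h. gradient f y \<bullet> h) - (\<lambda>h. gradient f x \<bullet> h)) \<le> N * norm z" if "y \<in> cball x (norm z)" for y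
      proof (rule onorm_le)
        fix h
        have "norm (gradient f y \<bullet> h - gradient f x \<bullet> h) \<le> norm (gradient f y - gradient f x) * norm h"
          using Cauchy_Schwarz_ineq2[of "gradient f y - gradient f x" h] by (simp add: inner_diff_left)
        also have "norm (gradient f y - gradient f x) \<le> N * norm (y - x)"
          using V[of x "y - x"] by simp
        also have "N * norm (y - x) \<le> N * norm z"
          using that N0 by (intro mult_left_mono) (auto simp: dist_norm norm_minus_commute)
        finally show "norm (((\<lambda>h. gradient f y \<bullet> h) - (\<lambda>h. gradient f x \<bullet> h)) h) \<le> (N * norm z) * norm h"
          by (simp add: mult_right_mono)
      qed
    qed auto
    then show ?thesis by (simp add: power2_eq_square mult_ac)
  qed
  have fm: "f \<in> borel_measurable borel"
    by (intro borel_measurable_continuous_onI continuous_at_imp_continuous_on ballI differentiable_imp_continuous_within d)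
  have Vm: "gradient f \<in> borel_measurable borel"
  proof (rule borel_measurable_continuous_onI)
    have "continuous_on UNIV (partial_deriv i f)" for i
      by (intro continuous_at_imp_continuous_on ballI differentiable_imp_continuous_within d1)
    then show "continuous_on UNIV (gradient f)"
      unfolding gradient_def[abs_def] by (intro continuous_on_vec_lambda)
  qed
  show ?thesis
    unfolding bounded_C11_def
    by (intro conjI exI[of _ A] exI[of _ L] exI[of _ N] allI fm Vm L N0 A V T
        lipschitz_of_gradient_bound[OF d L(2)])
qed

section \<open>Bounded mixtures of Gaussian measures\<close>

locale gaussian_mixture =
  fixes \<mu> :: "(real ^ 'd::finite) measure" and R t :: real
  assumes prob: "prob_space \<mu>" and sets_mu: "sets \<mu> = sets borel"
    and support: "measure \<mu> (cball 0 R) = 1"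
    and t_pos: "t > 0"
begin

sublocale \<mu>: prob_space \<mu> by (rule prob)

abbreviation "\<rho> \<equiv> convolution \<mu> (gaussian t)"

lemma prob_space_mixture: "prob_space \<rho>"
proof -
  interpret G: prob_space "gaussian t :: (real ^ 'd) measure" by (rule prob_space_gaussian) (rule t_pos)
  interpret P: pair_prob_space \<mu> "gaussian t :: (real ^ 'd) measure" ..
  note [measurable_cong] = sets_mu
  show ?thesis unfolding convolution_def by (rule P.prob_space_distr) measurable
qed

lemma measurable_mu [measurable_dest]: "f \<in> borel_measurable borel \<Longrightarrow> f \<in> borel_measurable \<mu>"
  using measurable_cong_sets[OF sets_mu refl] by blast

lemma AE_support: "AE x in \<mu>. x \<in> cball 0 R"
  using support by (subst \<mu>.AE_prob_1) auto

lemma integral_mixture: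
  fixes F :: "real ^ 'd \<Rightarrow> real"
  assumes "F \<in> borel_measurable borel" "\<And>x. \<bar>F x\<bar> \<le> B"
  shows "(\<integral>x. F x \<partial>\<rho>) = (\<integral>x. heat t F x \<partial>\<mu>)"
  unfolding heat_def
  by (rule integral_convolution[OF prob sets_mu prob_space_gaussian[OF t_pos] sets_gaussian assms])

lemma integrable_heat:
  fixes F :: "real ^ 'd \<Rightarrow> real"
  assumes [measurable]: "F \<in> borel_measurable borel" and "\<And>x. \<bar>F x\<bar> \<le> B"
  shows "integrable \<mu> (heat t F)"
proof (rule \<mu>.integrable_const_bound[of _ B])
  show "AE x in \<mu>. norm (heat t F x) \<le> B"
    using heat_norm_le[OF t_pos assms(1), of B] assms(2) by simp
qed (use t_pos in \<open>intro measurable_mu borel_measurable_heat assms\<close>)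

lemma norm_diff_support:
  assumes "x \<in> cball 0 R" "y \<in> cball 0 R"
  shows "(norm (y - x))\<^sup>2 / t \<le> 4 * R\<^sup>2 / t"
proof -
  have "norm (y - x) \<le> 2 * R"
    using assms norm_triangle_ineq4[of y x] by (simp add: dist_norm)
  then have "(norm (y - x))\<^sup>2 \<le> (2 * R)\<^sup>2" by (intro power_mono) auto
  then show ?thesis using t_pos by (simp add: divide_right_mono power_mult_distrib)
qed

text \<open>The variance under the mixture is the mean of the variances \<open>v\<close> of the components plus the variance of
  their means \<open>e\<close>. The latter is at most \<open>K - 1\<close> times the former, since any two means within the support differ by at most
  the square root of \<open>(K - 1) v\<close>.\<close>

theorem mixture_poincare:
  assumes f: "bounded_C11 f V"
  shows "(\<integral>x. (f x)\<^sup>2 \<partial>\<rho>) - (\<integral>x. f x \<partial>\<rho>)\<^sup>2 \<le> t * exp (4 * R\<^sup>2 / t) * (\<integral>x. (norm (V x))\<^sup>2 \<partial>\<rho>)"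
proof -
  let ?K = "exp (4 * R\<^sup>2 / t)"
  obtain A L where A: "0 \<le> A" "\<And>x. \<bar>f x\<bar> \<le> A" and L: "0 \<le> L" "\<And>x. norm (V x) \<le> L"
    and fm [measurable]: "f \<in> borel_measurable borel" and Vm [measurable]: "V \<in> borel_measurable borel"
    by (rule bounded_C11E[OF f]) blast
  have A2: "\<bar>(f x)\<^sup>2\<bar> \<le> A\<^sup>2" for x using A(2)[of x] by (metis abs_ge_zero power2_abs power_mono abs_power2)
  have L2: "\<bar>(norm (V x))\<^sup>2\<bar> \<le> L\<^sup>2" for x using L(2)[of x] by (simp add: power_mono)
  define m where "m = (\<integral>x. f x \<partial>\<rho>)"
  define e where "e = heat t f"
  define v where "v x = heat t (\<lambda>y. (f y)\<^sup>2) x - (e x)\<^sup>2" for x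
  have em: "e \<in> borel_measurable borel" unfolding e_def by (intro borel_measurable_heat fm t_pos)
  have eA: "\<bar>e x\<bar> \<le> A" for x unfolding e_def using heat_norm_le[OF t_pos fm, of A x] A by simp
  have Ie: "integrable \<mu> e" unfolding e_def by (rule integrable_heat[OF fm A(2)])
  have If2: "integrable \<mu> (heat t (\<lambda>y. (f y)\<^sup>2))" by (rule integrable_heat[OF _ A2]) measurable
  have Ie2: "integrable \<mu> (\<lambda>x. (e x)\<^sup>2)"
  proof (rule \<mu>.integrable_const_bound[of _ "A\<^sup>2"])
    show "AE x in \<mu>. norm ((e x)\<^sup>2) \<le> A\<^sup>2"
      using eA by (intro AE_I2) (metis abs_ge_zero power2_abs power_mono real_norm_def abs_power2)
    show "(\<lambda>x. (e x)\<^sup>2) \<in> borel_measurable \<mu>" using em by (intro measurable_mu borel_measurable_power)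
  qed
  have Iv: "integrable \<mu> v" unfolding v_def[abs_def] using If2 Ie2 by auto
  have m: "m = (\<integral>x. e x \<partial>\<mu>)" unfolding m_def e_def by (rule integral_mixture[OF fm A(2)])
  have dev: "(e x - m)\<^sup>2 \<le> (?K - 1) * v x" if x: "x \<in> cball 0 R" for x
  proof -
    have sq: "(e y - e x)\<^sup>2 \<le> (?K - 1) * v x" if y: "y \<in> cball 0 R" for y
    proof -
      \<comment> \<open>the variance is nonnegative, by comparison along any nonzero translation\<close>
      define a where "a = exp ((norm (axis undefined 1 :: real ^ 'd))\<^sup>2 / t) - 1"
      have "0 < a" using t_pos by (simp add: a_def)
      moreover have "0 \<le> a * v x"
        unfolding a_def v_def e_def
        by (rule order_trans[OF zero_le_power2 heat_difference_square[OF t_pos fm A(2)]])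
      ultimately have "0 \<le> v x" by (simp add: zero_le_mult_iff)
      have "(e y - e x)\<^sup>2 \<le> (exp ((norm (y - x))\<^sup>2 / t) - 1) * v x"
        using heat_difference_square[OF t_pos fm A(2), of x "y - x"] by (simp add: v_def e_def)
      also have "\<dots> \<le> (?K - 1) * v x"
        using \<open>0 \<le> v x\<close> norm_diff_support[OF x y] by (intro mult_right_mono) auto
      finally show ?thesis .
    qed
    define b where "b = sqrt ((?K - 1) * v x)"
    have "\<bar>m - e x\<bar> = \<bar>\<integral>y. e y - e x \<partial>\<mu>\<bar>" using Ie by (simp add: m \<mu>.prob_space)
    also have "\<dots> \<le> (\<integral>y. \<bar>e y - e x\<bar> \<partial>\<mu>)" using integral_norm_bound[of \<mu> "\<lambda>y. e y - e x"] by simp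
    also have "\<dots> \<le> (\<integral>y. b \<partial>\<mu>)"
    proof (rule integral_mono_AE)
      show "AE y in \<mu>. \<bar>e y - e x\<bar> \<le> b"
        using AE_support by eventually_elim (use sq in \<open>auto simp: b_def intro!: real_le_rsqrt\<close>)
    qed (use Ie in auto)
    finally have "\<bar>m - e x\<bar> \<le> b" by (simp add: \<mu>.prob_space)
    then have "(m - e x)\<^sup>2 \<le> b\<^sup>2" by (metis abs_ge_zero power2_abs power_mono)
    moreover have "0 \<le> (?K - 1) * v x" using sq[OF x] by simp
    ultimately show ?thesis by (simp add: b_def power2_commute)
  qed
  have "(\<integral>x. (f x)\<^sup>2 \<partial>\<rho>) - m\<^sup>2 = (\<integral>x. heat t (\<lambda>y. (f y)\<^sup>2) x \<partial>\<mu>) - m\<^sup>2"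
    by (subst integral_mixture[OF _ A2]) auto
  also have "\<dots> = (\<integral>x. v x + (e x - m)\<^sup>2 \<partial>\<mu>)"
  proof -
    have "(\<integral>x. v x + (e x - m)\<^sup>2 \<partial>\<mu>) = (\<integral>x. heat t (\<lambda>y. (f y)\<^sup>2) x + (m\<^sup>2 - 2 * m * e x) \<partial>\<mu>)"
      by (intro Bochner_Integration.integral_cong) (auto simp: v_def power2_eq_square algebra_simps)
    also have "\<dots> = (\<integral>x. heat t (\<lambda>y. (f y)\<^sup>2) x \<partial>\<mu>) + (m\<^sup>2 - 2 * m * m)"
      using If2 Ie by (simp add: \<mu>.prob_space m[symmetric])
    finally show ?thesis by (simp add: power2_eq_square)
  qed
  also have "\<dots> \<le> (\<integral>x. ?K * (t * heat t (\<lambda>y. (norm (V y))\<^sup>2) x) \<partial>\<mu>)"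
  proof (rule integral_mono_AE)
    have "integrable \<mu> (\<lambda>x. (e x)\<^sup>2 + m\<^sup>2 - 2 * m * e x)" using Ie Ie2 by auto
    then have "integrable \<mu> (\<lambda>x. (e x - m)\<^sup>2)" by (simp add: power2_diff mult_ac)
    then show "integrable \<mu> (\<lambda>x. v x + (e x - m)\<^sup>2)" using Iv by auto
    show "integrable \<mu> (\<lambda>x. ?K * (t * heat t (\<lambda>y. (norm (V y))\<^sup>2) x))"
      by (intro integrable_mult_right integrable_heat[OF _ L2]) measurable
    show "AE x in \<mu>. v x + (e x - m)\<^sup>2 \<le> ?K * (t * heat t (\<lambda>y. (norm (V y))\<^sup>2) x)"
      using AE_support
    proof eventually_elim
      fix x :: "real ^ 'd" assume "x \<in> cball 0 R"
      then have "v x + (e x - m)\<^sup>2 \<le> ?K * v x" using dev[of x] by (simp add: algebra_simps)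
      also have "v x \<le> t * heat t (\<lambda>y. (norm (V y))\<^sup>2) x"
        using heat_poincare[OF t_pos f, of x] by (simp add: v_def e_def)
      finally show "v x + (e x - m)\<^sup>2 \<le> ?K * (t * heat t (\<lambda>y. (norm (V y))\<^sup>2) x)" by simp
    qed
  qed
  also have "\<dots> = t * ?K * (\<integral>x. (norm (V x))\<^sup>2 \<partial>\<rho>)"
    by (subst integral_mixture[OF _ L2]) auto
  finally show ?thesis by (simp add: m_def)
qed

text \<open>The entropy under the mixture is the mean of the entropies of the components plus the entropy of their
  means \<open>g\<close>. The Harnack inequality, averaged over the second point, bounds \<open>g ln (g / m)\<close> by the entropy of the
  component plus \<open>4 R\<^sup>2 / t\<close> times \<open>g\<close>; so the entropies of the components are counted twice.\<close>

theorem mixture_defective_log_sobolev: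
  assumes f: "bounded_C11 f V"
  shows "ent \<rho> (\<lambda>x. (f x)\<^sup>2) \<le> 8 * t * (\<integral>x. (norm (V x))\<^sup>2 \<partial>\<rho>) + (4 * R\<^sup>2 / t) * (\<integral>x. (f x)\<^sup>2 \<partial>\<rho>)"
proof -
  let ?F = "\<lambda>x. (f x)\<^sup>2"
  obtain A L where A: "0 \<le> A" "\<And>x. \<bar>f x\<bar> \<le> A" and L: "0 \<le> L" "\<And>x. norm (V x) \<le> L"
    and fm [measurable]: "f \<in> borel_measurable borel" and Vm [measurable]: "V \<in> borel_measurable borel"
    by (rule bounded_C11E[OF f]) blast
  have A2: "?F x \<le> A\<^sup>2" for x using A(2)[of x] by (metis abs_ge_zero power2_abs power_mono)
  then have A2': "\<bar>?F x\<bar> \<le> A\<^sup>2" for x by simp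
  have L2: "\<bar>(norm (V x))\<^sup>2\<bar> \<le> L\<^sup>2" for x using L(2)[of x] by (simp add: power_mono)
  have Al: "\<bar>?F x * ln (?F x)\<bar> \<le> 1 + (A\<^sup>2)\<^sup>2" for x by (rule abs_x_ln_x_le) (auto simp: A2)
  define m where "m = (\<integral>x. ?F x \<partial>\<rho>)"
  define g where "g = heat t ?F"
  define H where "H = heat t (\<lambda>y. ?F y * ln (?F y))"
  define G where "G = heat t (\<lambda>y. (norm (V y))\<^sup>2)"
  have Ig: "integrable \<mu> g" unfolding g_def by (rule integrable_heat[OF _ A2']) measurable
  have IH: "integrable \<mu> H" unfolding H_def by (rule integrable_heat[OF _ Al]) measurable
  have IG: "integrable \<mu> G" unfolding G_def by (rule integrable_heat[OF _ L2]) measurable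
  have m: "m = (\<integral>x. g x \<partial>\<mu>)" unfolding m_def g_def by (rule integral_mixture[OF _ A2']) measurable
  have g0: "0 \<le> g x" for x unfolding g_def heat_def by simp
  have H: "(\<integral>x. ?F x * ln (?F x) \<partial>\<rho>) = (\<integral>x. H x \<partial>\<mu>)"
    unfolding H_def by (rule integral_mixture[OF _ Al]) measurable
  have G: "(\<integral>x. (norm (V x))\<^sup>2 \<partial>\<rho>) = (\<integral>x. G x \<partial>\<mu>)"
    unfolding G_def by (rule integral_mixture[OF _ L2]) measurable
  have main: "H x \<le> g x * ln m + 8 * t * G x + (4 * R\<^sup>2 / t) * g x" if x: "x \<in> cball 0 R" for x
  proof (cases "g x = 0")
    case True
    have I: "integrable (gaussian t) (\<lambda>z. ?F (x + z))"
      by (rule integrable_gaussian_bounded[OF t_pos, of ?F "A\<^sup>2"]) (use A2' in auto)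
    have "AE z in gaussian t. ?F (x + z) = 0"
      using I True by (subst integral_nonneg_eq_0_iff_AE[symmetric]) (auto simp: g_def heat_def)
    then have "H x = (\<integral>z. 0 \<partial>(gaussian t :: (real ^ 'd) measure))"
      unfolding H_def heat_def by (intro integral_cong_AE) (auto elim!: eventually_mono)
    moreover have "0 \<le> G x" unfolding G_def heat_def by simp
    ultimately show ?thesis using True t_pos by simp
  next
    case False
    then have gx: "g x > 0" using g0[of x] by simp
    define E where "E = H x - g x * ln (g x)"
    define b where "b = g x * exp (- (E / g x + 4 * R\<^sup>2 / t))"
    have "b \<le> g y" if y: "y \<in> cball 0 R" for y
    proof -
      have "g x * exp (- (E / g x + (norm (y - x))\<^sup>2 / t)) \<le> g y"
        using heat_harnack[of t ?F "A\<^sup>2" x "y - x"] A2 gx t_pos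
        by (simp add: E_def H_def g_def)
      moreover have "b \<le> g x * exp (- (E / g x + (norm (y - x))\<^sup>2 / t))"
        unfolding b_def using norm_diff_support[OF x y] gx by (intro mult_left_mono) auto
      ultimately show ?thesis by linarith
    qed
    then have "(\<integral>y. b \<partial>\<mu>) \<le> (\<integral>y. g y \<partial>\<mu>)"
      using AE_support Ig by (intro integral_mono_AE) (auto elim!: eventually_mono)
    then have bm: "b \<le> m" by (simp add: m \<mu>.prob_space)
    have b: "b > 0" using gx by (simp add: b_def)
    have "ln b \<le> ln m" using bm b by simp
    moreover have "ln b = ln (g x) - (E / g x + 4 * R\<^sup>2 / t)"
      using gx unfolding b_def by (subst ln_mult) auto
    ultimately have "g x * (ln (g x) - (E / g x + 4 * R\<^sup>2 / t)) \<le> g x * ln m"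
      using gx by (intro mult_left_mono) auto
    then have "g x * ln (g x) \<le> g x * ln m + E + (4 * R\<^sup>2 / t) * g x"
      using gx by (simp add: algebra_simps)
    moreover have "E \<le> 4 * t * G x"
      using heat_log_sobolev[OF t_pos f, of x] by (simp add: E_def H_def g_def G_def)
    ultimately show ?thesis by (simp add: E_def)
  qed
  have "(\<integral>x. H x \<partial>\<mu>) \<le> (\<integral>x. g x * ln m + 8 * t * G x + (4 * R\<^sup>2 / t) * g x \<partial>\<mu>)"
    using AE_support Ig IG IH main by (intro integral_mono_AE) (auto elim!: eventually_mono)
  also have "\<dots> = m * ln m + 8 * t * (\<integral>x. G x \<partial>\<mu>) + (4 * R\<^sup>2 / t) * m"
    using Ig IG by (simp add: m)
  finally show ?thesis unfolding ent_def H G m_def[symmetric] by simp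
qed

end

lemma bounded_C11_diff_const:
  assumes "bounded_C11 f V"
  shows "bounded_C11 (\<lambda>x. f x - c) V"
proof -
  obtain A L M where *: "0 \<le> L" "0 \<le> M"
    "f \<in> borel_measurable borel" "V \<in> borel_measurable borel"
    "\<And>x. \<bar>f x\<bar> \<le> A" "\<And>x. norm (V x) \<le> L"
    "\<And>x z. \<bar>f (x + z) - f x\<bar> \<le> L * norm z" "\<And>x z. norm (V (x + z) - V x) \<le> M * norm z"
    "\<And>x z. \<bar>f (x + z) - f x - V x \<bullet> z\<bar> \<le> M * (norm z)\<^sup>2"
    by (rule bounded_C11E[OF assms]) blast
  have "\<bar>f x - c\<bar> \<le> A + \<bar>c\<bar>" for x using *(5)[of x] by linarith
  moreover have "(\<lambda>x. f x - c) \<in> borel_measurable borel" using *(3) by measurable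
  moreover have "f (x + z) - c - (f x - c) = f (x + z) - f x" for x z by simp
  ultimately show ?thesis unfolding bounded_C11_def
    by (intro conjI exI[of _ "A + \<bar>c\<bar>"] exI[of _ L] exI[of _ M] allI) (simp_all only: *)
qed

theorem corollary1:
  fixes \<mu> :: "(real ^ 'd::finite) measure" and R t :: real
  assumes "prob_space \<mu>" and "sets \<mu> = sets borel"
    and "R \<ge> 0"
    and "measure \<mu> (cball 0 R) = 1"
    and "t > 0"
  shows "satisfies_log_sobolev (convolution \<mu> (gaussian t)) \<and>
         C_LS (convolution \<mu> (gaussian t)) \<le> ereal (6 * (4 * R\<^sup>2 + t) * exp (4 * R\<^sup>2 / t))"
proof -
  interpret gaussian_mixture \<mu> R t by (rule gaussian_mixture.intro) (fact assms)+
  interpret \<rho>: prob_space \<rho> by (rule prob_space_mixture)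
  let ?K = "exp (4 * R\<^sup>2 / t)"
  have "log_sobolev_ineq \<rho> (6 * (4 * R\<^sup>2 + t) * ?K)"
    unfolding log_sobolev_ineq_def
  proof
    fix f :: "real ^ 'd \<Rightarrow> real" assume "f \<in> Cb_infty"
    then have f: "bounded_C11 f (gradient f)" by (rule bounded_C11_Cb_infty)
    define m where "m = (\<integral>x. f x \<partial>\<rho>)"
    define D where "D = (\<integral>x. (norm (gradient f x))\<^sup>2 \<partial>\<rho>)"
    define S where "S = (\<integral>x. (f x - m)\<^sup>2 \<partial>\<rho>)"
    have h: "bounded_C11 (\<lambda>x. f x - m) (gradient f)" by (rule bounded_C11_diff_const[OF f])
    obtain A where A: "0 \<le> A" "\<And>x. \<bar>f x\<bar> \<le> A" and fm [measurable]: "f \<in> borel_measurable borel"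
      by (rule bounded_C11E[OF f]) blast
    have D0: "D \<ge> 0" by (simp add: D_def)
    have If: "integrable \<rho> f" by (rule \<rho>.integrable_const_bound[of _ A]) (auto simp: A)
    have "(\<integral>x. f x - m \<partial>\<rho>) = 0" using If by (simp add: m_def \<rho>.prob_space[simplified])
    then have S: "S \<le> t * ?K * D"
      using mixture_poincare[OF h] by (simp add: S_def D_def)
    have "ent \<rho> (\<lambda>x. (f x)\<^sup>2) \<le> ent \<rho> (\<lambda>x. (f x - m)\<^sup>2) + 4 * S"
      using \<rho>.ent_square_shift[of f A] A by (simp add: m_def S_def)
    also have "ent \<rho> (\<lambda>x. (f x - m)\<^sup>2) \<le> 8 * t * D + (4 * R\<^sup>2 / t) * S"
      using mixture_defective_log_sobolev[OF h] by (simp add: S_def D_def)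
    also have "8 * t * D + (4 * R\<^sup>2 / t) * S + 4 * S = 8 * t * D + (4 * R\<^sup>2 / t + 4) * S"
      by (simp add: algebra_simps)
    also have "\<dots> \<le> 8 * t * D * ?K + (4 * R\<^sup>2 / t + 4) * (t * ?K * D)"
    proof (intro add_mono mult_left_mono S)
      have "8 * t * D * 1 \<le> 8 * t * D * ?K"
        using D0 t_pos by (intro mult_left_mono) auto
      then show "8 * t * D \<le> 8 * t * D * ?K" by simp
    qed (use t_pos in auto)
    also have "\<dots> = (4 * R\<^sup>2 + 12 * t) * (?K * D)"
      using t_pos by (simp add: field_simps)
    also have "\<dots> \<le> (12 * (4 * R\<^sup>2 + t)) * (?K * D)"
      using D0 by (intro mult_right_mono) auto
    finally show "ent \<rho> (\<lambda>x. (f x)\<^sup>2) \<le> 2 * (6 * (4 * R\<^sup>2 + t) * ?K) * (\<integral>x. (norm (gradient f x))\<^sup>2 \<partial>\<rho>)"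
      by (simp add: D_def algebra_simps)
  qed
  then have le: "C_LS \<rho> \<le> ereal (6 * (4 * R\<^sup>2 + t) * ?K)" by (simp only: C_LS_le_iff)
  moreover have "satisfies_log_sobolev \<rho>"
    unfolding satisfies_log_sobolev_def using le_less_trans[OF le, of "\<infinity>"] by simp
  ultimately show ?thesis by simp
qed

end
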